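(* Let $f:X\to\mathcal{E}^{1,2}$ be a regular quasi-umbilical immersion with directrix curve $\Gamma:\Lambda\to S^{2,2}$. Then $f$ is exceptional if and only if $\Gamma$ is biisotropic.
   Context: Ambient spaces. $\mathbb{R}^{2,3}$ is $\mathbb{R}^5$ with $\langle X,Y\rangle=-(X^0Y^4+X^4Y^0)-X^1Y^1+X^2Y^2+X^3Y^3$. $G=\mathrm{O}^{\uparrow}_+(2,3)$ is the identity component of its isometry group. $[X]$ is the ray spanned by $X\ne0$. $\mathcal{E}^{1,2}$ (Einstein universe) is the manifold of null rays of $\mathbb{R}^{2,3}$. With $(E_i)$ the standard basis, $P_0=(E_0+E_4)/\sqrt2$, $P_i=E_i$ ($i=1,2,3$), $P_4=(E_4-E_0)/\sqrt2$, each null ray has a unique representative in $S^1_-\times S^2_+$ (unit circle of $\mathrm{span}(P_0,P_1)$ times unit sphere of $\mathrm{span}(P_2,P_3,P_4)$), and $g_{\mathcal{E}}$ is the induced Lorentzian metric. $S^{2,2}=\{V:\langle V,V\rangle=1\}$. Frames and quasi-umbilical immersions. $X$ is a connected oriented surface. An immersion $f:X\to\mathcal{E}^{1,2}$ is timelike if $f^*g_{\mathcal{E}}$ is Lorentzian. A conformal frame field is a smooth map $F:U\to G$, $U\subset X$ open, with columns $F_0,\dots,F_4$ and $f=[F_0]$; write $dF_k=\sum_j\phi^j_kF_j$. It is of second order if $\phi^3_0=0$, $\phi^1_0\wedge\phi^2_0>0$ and $\phi^3_1\wedge\phi^2_0+\phi^3_2\wedge\phi^1_0=0$. Such frames exist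 locally and all have the same $F_3$; the conformal Gauss map is $\mathcal{N}_f=F_3:X\to S^{2,2}$. One has $\langle d\mathcal{N}_f,d\mathcal{N}_f\rangle=\varrho_f f^*g_{\mathcal{E}}$. A timelike immersion $f$ is quasi-umbilical if $\varrho_f(x)=0$ and $f(x)\wedge d\mathcal{N}_f|_x\ne0$ for every $x\in X$ ($f$ denoting also a lift to $\mathbb{R}^{2,3}$). For quasi-umbilical $f$, $X$ is given the canonical orientation, the one for which second order frames satisfy $\phi^3_1=\phi^3_2=h(\phi^1_0+\phi^2_0)$ with $h$ nowhere zero; put $\varepsilon=\mathrm{sgn}\,h$. An adapted frame field is a second order one with $h=\varepsilon$, $\phi^3_4=0$, $\phi^0_0=2\phi^2_1$, $(\phi^1_4+\phi^2_4)\wedge(\phi^1_0+\phi^2_0)=0$; adapted frames exist locally and $[F_4]$ is independent of the choice, defining the dual map $f^\sharp=[F_4]:X\to\mathcal{E}^{1,2}$. $f$ is exceptional if the quadratic form $\langle d\mathcal{N}_f,df^\sharp\rangle$ (computed with any lift of $f^\sharp$) vanishes identically on $X$. $f$ is regular if the leaf space $\Lambda$ of $\ker d\mathcal{N}_f$ is Hausdorff; then $\Lambda$ is a connected 1-manifold, the projection $\pi:X\to\Lambda$ is a submersion with connected fibers, and $\mathcal{N}_f=\Gamma\circ\pi$ with $\Gamma:\Lambda\to S^{2,2}$ a null immersed curve, the directrix curve of $f$. Biisotropic. For a nowhere zero 1-form $\zeta$ on $\Lambda$, primes denote derivatives with respect to $\zeta$ ($dH=H'\zeta$). An immersed curve $\Gamma:\Lambda\to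 S^{2,2}$ is biisotropic if $\langle\Gamma',\Gamma'\rangle=\langle\Gamma'',\Gamma''\rangle=0$ and $(\Gamma'\wedge\Gamma'')|_\tau\neq0$ for every $\tau\in\Lambda$ (independent of $\zeta$). *)

theory Defs
  imports "HOL-Analysis.Analysis"
begin

section \<open>Smooth manifolds given by an atlas\<close>

text \<open>\<open>Ck_on k f S\<close> is meant for open \<open>S\<close>: \<open>f\<close> is \<open>k\<close> times continuously differentiable on \<open>S\<close>.\<close>

primrec Ck_on :: "nat \<Rightarrow> ('e::real_normed_vector \<Rightarrow> 'b::real_normed_vector) \<Rightarrow> 'e set \<Rightarrow> bool" where
  "Ck_on 0 f S \<longleftrightarrow> continuous_on S f"
| "Ck_on (Suc k) f S \<longleftrightarrow> (\<forall>p\<in>S. f differentiable (at p)) \<and>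
     (\<forall>v. Ck_on k (\<lambda>p. frechet_derivative f (at p) v) S)"

definition smooth_on :: "('e::real_normed_vector \<Rightarrow> 'b::real_normed_vector) \<Rightarrow> 'e set \<Rightarrow> bool" where
  "smooth_on f S \<longleftrightarrow> (\<forall>k. Ck_on k f S)"

type_synonym ('a, 'e) chart = "'a set \<times> ('a \<Rightarrow> 'e)"

abbreviation dom :: "('a, 'e) chart \<Rightarrow> 'a set" where "dom c \<equiv> fst c"
abbreviation coord :: "('a, 'e) chart \<Rightarrow> 'a \<Rightarrow> 'e" where "coord c \<equiv> snd c"
abbreviation param :: "('a, 'e) chart \<Rightarrow> 'e \<Rightarrow> 'a" where "param c \<equiv> inv_into (dom c) (coord c)"

definition is_chart :: "'a topology \<Rightarrow> ('a, 'e::euclidean_space) chart \<Rightarrow> bool" where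
  "is_chart X c \<longleftrightarrow> openin X (dom c) \<and> open (coord c ` dom c) \<and>
     homeomorphic_map (subtopology X (dom c)) (top_of_set (coord c ` dom c)) (coord c)"

text \<open>The atlas need not be maximal.\<close>

definition smooth_manifold :: "'a topology \<Rightarrow> ('a, 'e::euclidean_space) chart set \<Rightarrow> bool" where
  "smooth_manifold X A \<longleftrightarrow> Hausdorff_space X \<and> second_countable X \<and>
     (\<forall>c\<in>A. is_chart X c) \<and> (\<Union>c\<in>A. dom c) = topspace X \<and>
     (\<forall>c\<in>A. \<forall>d\<in>A. smooth_on (coord d \<circ> param c) (coord c ` (dom c \<inter> dom d)))"

definition oriented_atlas :: "('a, real^2) chart set \<Rightarrow> bool" where
  "oriented_atlas A \<longleftrightarrow> (\<forall>c\<in>A. \<forall>d\<in>A. \<forall>p\<in>coord c ` (dom c \<inter> dom d).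
     det (jacobian (coord d \<circ> param c) (at p)) > 0)"

definition connected_oriented_surface :: "'a topology \<Rightarrow> ('a, real^2) chart set \<Rightarrow> bool" where
  "connected_oriented_surface X A \<longleftrightarrow> smooth_manifold X A \<and> connected_space X \<and> oriented_atlas A"

definition smooth_map ::
    "('a, 'e::euclidean_space) chart set \<Rightarrow> 'a set \<Rightarrow> ('a \<Rightarrow> 'b::real_normed_vector) \<Rightarrow> bool" where
  "smooth_map A U H \<longleftrightarrow> (\<forall>c\<in>A. smooth_on (H \<circ> param c) (coord c ` (U \<inter> dom c)))"

text \<open>A tangent vector at \<open>x\<close> is represented by a chart \<open>c\<close> around \<open>x\<close> and its coordinate vector \<open>v\<close>
  in that chart; \<open>diff_in c H x v\<close> is the value of \<open>dH\<close> on it.\<close>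

definition diff_in :: "('a, 'e::euclidean_space) chart \<Rightarrow> ('a \<Rightarrow> 'b::real_normed_vector) \<Rightarrow> 'a \<Rightarrow> 'e \<Rightarrow> 'b" where
  "diff_in c H x v = frechet_derivative (H \<circ> param c) (at (coord c x)) v"

text \<open>A 1-form is a family \<open>\<omega> c x v\<close> of values in the charts \<open>c\<close> that obeys the transformation rule.\<close>

definition one_form ::
    "('a, 'e::euclidean_space) chart set \<Rightarrow> (('a, 'e) chart \<Rightarrow> 'a \<Rightarrow> 'e \<Rightarrow> real) \<Rightarrow> bool" where
  "one_form A \<omega> \<longleftrightarrow>
     (\<forall>c\<in>A. \<forall>x\<in>dom c. linear (\<omega> c x)) \<and>
     (\<forall>c\<in>A. \<forall>v. smooth_on (\<lambda>p. \<omega> c (param c p) v) (coord c ` dom c)) \<and>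
     (\<forall>c\<in>A. \<forall>d\<in>A. \<forall>x\<in>dom c \<inter> dom d. \<forall>v. \<omega> c x v = \<omega> d x (diff_in c (coord d) x v))"

definition nowhere_zero_one_form ::
    "('a, 'e::euclidean_space) chart set \<Rightarrow> (('a, 'e) chart \<Rightarrow> 'a \<Rightarrow> 'e \<Rightarrow> real) \<Rightarrow> bool" where
  "nowhere_zero_one_form A \<omega> \<longleftrightarrow> one_form A \<omega> \<and> (\<forall>c\<in>A. \<forall>x\<in>dom c. \<exists>v. \<omega> c x v \<noteq> 0)"

text \<open>\<open>(\<alpha> \<and> \<beta>)(u, v)\<close> for 1-forms at a point.\<close>

definition wedge :: "('e \<Rightarrow> real) \<Rightarrow> ('e \<Rightarrow> real) \<Rightarrow> 'e \<Rightarrow> 'e \<Rightarrow> real" where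
  "wedge \<alpha> \<beta> u v = \<alpha> u * \<beta> v - \<alpha> v * \<beta> u"

section \<open>The ambient space and the Einstein universe\<close>

text \<open>Components are numbered by the elements \<open>0, \<dots>, 4\<close> of the type \<open>5\<close>.\<close>

definition ip :: "real^5 \<Rightarrow> real^5 \<Rightarrow> real" where
  "ip V W = - (V$0 * W$4 + V$4 * W$0) - V$1 * W$1 + V$2 * W$2 + V$3 * W$3"

text \<open>The bivector \<open>V \<and> W\<close>, as an antisymmetric matrix.\<close>

definition bivector :: "real^5 \<Rightarrow> real^5 \<Rightarrow> real^5^5" where
  "bivector V W = (\<chi> i j. V$i * W$j - V$j * W$i)"

definition isometries :: "(real^5^5) set" where
  "isometries = {M. \<forall>V W. ip (M *v V) (M *v W) = ip V W}"

definition G23 :: "(real^5^5) set" where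
  "G23 = connected_component_set isometries (mat 1)"

definition S22 :: "(real^5) set" where
  "S22 = {V. ip V V = 1}"

definition ray :: "real^5 \<Rightarrow> (real^5) set" where
  "ray V = {r *\<^sub>R V | r. r > 0}"

definition einstein :: "(real^5) set set" where
  "einstein = {ray V | V. V \<noteq> 0 \<and> ip V V = 0}"

definition pbasis :: "5 \<Rightarrow> real^5" where
  "pbasis i = (if i = 0 then (axis 0 1 + axis 4 1) /\<^sub>R sqrt 2
               else if i = 4 then (axis 4 1 - axis 0 1) /\<^sub>R sqrt 2 else axis i 1)"

definition S1xS2 :: "(real^5) set" where
  "S1xS2 = {p + q | p q. p \<in> span {pbasis 0, pbasis 1} \<and> ip p p = - 1 \<and>
     q \<in> span {pbasis 2, pbasis 3, pbasis 4} \<and> ip q q = 1}"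

text \<open>The identification of the Einstein universe with \<open>S1xS2\<close>, a submanifold of \<open>\<real>\<^sup>5\<close> on which
  \<open>g\<^sub>\<E>\<close> is the restriction of \<open>ip\<close>.\<close>

definition normalized :: "(real^5) set \<Rightarrow> real^5" where
  "normalized \<rho> = (THE V. V \<in> \<rho> \<and> V \<in> S1xS2)"

definition pullback_metric ::
    "('a \<Rightarrow> (real^5) set) \<Rightarrow> ('a, real^2) chart \<Rightarrow> 'a \<Rightarrow> real^2 \<Rightarrow> real^2 \<Rightarrow> real" where
  "pullback_metric f c x u v =
     ip (diff_in c (normalized \<circ> f) x u) (diff_in c (normalized \<circ> f) x v)"

definition lorentzian :: "(real^2 \<Rightarrow> real^2 \<Rightarrow> real) \<Rightarrow> bool" where
  "lorentzian g \<longleftrightarrow> (\<exists>u v. g u u = - 1 \<and> g v v = 1 \<and> g u v = 0)"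

definition timelike_immersion ::
    "'a topology \<Rightarrow> ('a, real^2) chart set \<Rightarrow> ('a \<Rightarrow> (real^5) set) \<Rightarrow> bool" where
  "timelike_immersion X A f \<longleftrightarrow> f ` topspace X \<subseteq> einstein \<and>
     smooth_map A (topspace X) (normalized \<circ> f) \<and>
     (\<forall>c\<in>A. \<forall>x\<in>dom c. inj (diff_in c (normalized \<circ> f) x) \<and> lorentzian (pullback_metric f c x))"

section \<open>Frames and quasi-umbilical immersions\<close>

definition conformal_frame :: "'a topology \<Rightarrow> ('a, real^2) chart set \<Rightarrow> ('a \<Rightarrow> (real^5) set) \<Rightarrow>
    'a set \<Rightarrow> ('a \<Rightarrow> real^5^5) \<Rightarrow> bool" where
  "conformal_frame X A f U F \<longleftrightarrow> openin X U \<and> smooth_map A U F \<and>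
     (\<forall>x\<in>U. F x \<in> G23 \<and> f x = ray (column 0 (F x)))"

text \<open>\<open>phi c F j k\<close> is \<open>\<phi>\<^sup>j\<^sub>k\<close>: the equations \<open>dF\<^sub>k = \<Sum>\<^sub>j \<phi>\<^sup>j\<^sub>k F\<^sub>j\<close> amount to \<open>dF = F \<phi>\<close>.\<close>

definition phi :: "('a, real^2) chart \<Rightarrow> ('a \<Rightarrow> real^5^5) \<Rightarrow> 5 \<Rightarrow> 5 \<Rightarrow> 'a \<Rightarrow> real^2 \<Rightarrow> real" where
  "phi c F j k x v = (matrix_inv (F x) ** diff_in c F x v) $ j $ k"

definition second_order_frame :: "'a topology \<Rightarrow> ('a, real^2) chart set \<Rightarrow> ('a \<Rightarrow> (real^5) set) \<Rightarrow>
    'a set \<Rightarrow> ('a \<Rightarrow> real^5^5) \<Rightarrow> bool" where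
  "second_order_frame X A f U F \<longleftrightarrow> conformal_frame X A f U F \<and>
     (\<forall>c\<in>A. \<forall>x\<in>U \<inter> dom c.
        (\<forall>v. phi c F 3 0 x v = 0) \<and>
        wedge (phi c F 1 0 x) (phi c F 2 0 x) (axis 1 1) (axis 2 1) > 0 \<and>
        (\<forall>u v. wedge (phi c F 3 1 x) (phi c F 2 0 x) u v
              + wedge (phi c F 3 2 x) (phi c F 1 0 x) u v = 0))"

definition conformal_gauss_map :: "'a topology \<Rightarrow> ('a, real^2) chart set \<Rightarrow> ('a \<Rightarrow> (real^5) set) \<Rightarrow>
    ('a \<Rightarrow> real^5) \<Rightarrow> bool" where
  "conformal_gauss_map X A f N \<longleftrightarrow>
     (\<forall>x\<in>topspace X. \<exists>U F. x \<in> U \<and> second_order_frame X A f U F \<and> (\<forall>y\<in>U. N y = column 3 (F y)))"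

text \<open>\<open>\<langle>dN, dN\<rangle> = r f\<^sup>*g\<^sub>\<E>\<close> at \<open>x\<close>, i.e. \<open>r = \<rho>\<^sub>f(x)\<close> when \<open>N\<close> is the conformal Gauss map of \<open>f\<close>.\<close>

definition conformal_factor_at :: "('a, real^2) chart set \<Rightarrow> ('a \<Rightarrow> (real^5) set) \<Rightarrow>
    ('a \<Rightarrow> real^5) \<Rightarrow> 'a \<Rightarrow> real \<Rightarrow> bool" where
  "conformal_factor_at A f N x r \<longleftrightarrow> (\<forall>c\<in>A. x \<in> dom c \<longrightarrow>
     (\<forall>u v. ip (diff_in c N x u) (diff_in c N x v) = r * pullback_metric f c x u v))"

definition quasi_umbilical :: "'a topology \<Rightarrow> ('a, real^2) chart set \<Rightarrow> ('a \<Rightarrow> (real^5) set) \<Rightarrow>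
    ('a \<Rightarrow> real^5) \<Rightarrow> bool" where
  "quasi_umbilical X A f N \<longleftrightarrow> timelike_immersion X A f \<and> conformal_gauss_map X A f N \<and>
     (\<forall>x\<in>topspace X. conformal_factor_at A f N x 0 \<and>
        (\<forall>c\<in>A. x \<in> dom c \<longrightarrow> (\<exists>v. bivector (normalized (f x)) (diff_in c N x v) \<noteq> 0)))"

text \<open>The orientation given by the atlas is the canonical one of the quasi-umbilical immersion.\<close>

definition canonically_oriented ::
    "'a topology \<Rightarrow> ('a, real^2) chart set \<Rightarrow> ('a \<Rightarrow> (real^5) set) \<Rightarrow> bool" where
  "canonically_oriented X A f \<longleftrightarrow> (\<forall>U F. second_order_frame X A f U F \<longrightarrow>
     (\<forall>c\<in>A. \<forall>x\<in>U \<inter> dom c. \<exists>h. h \<noteq> 0 \<and>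
        (\<forall>v. phi c F 3 1 x v = h * (phi c F 1 0 x v + phi c F 2 0 x v) \<and>
             phi c F 3 2 x v = h * (phi c F 1 0 x v + phi c F 2 0 x v))))"

text \<open>The sign of \<open>h\<close> is the same for all second order frames, so the normalization \<open>h = sgn h\<close>
  is imposed pointwise.\<close>

definition adapted_frame :: "'a topology \<Rightarrow> ('a, real^2) chart set \<Rightarrow> ('a \<Rightarrow> (real^5) set) \<Rightarrow>
    'a set \<Rightarrow> ('a \<Rightarrow> real^5^5) \<Rightarrow> bool" where
  "adapted_frame X A f U F \<longleftrightarrow> second_order_frame X A f U F \<and>
     (\<forall>c\<in>A. \<forall>x\<in>U \<inter> dom c.
        (\<exists>h. h \<noteq> 0 \<and> h = sgn h \<and>
           (\<forall>v. phi c F 3 1 x v = h * (phi c F 1 0 x v + phi c F 2 0 x v) \<and>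
                phi c F 3 2 x v = h * (phi c F 1 0 x v + phi c F 2 0 x v))) \<and>
        (\<forall>v. phi c F 3 4 x v = 0 \<and> phi c F 0 0 x v = 2 * phi c F 2 1 x v) \<and>
        (\<forall>u v. wedge (\<lambda>w. phi c F 1 4 x w + phi c F 2 4 x w)
                     (\<lambda>w. phi c F 1 0 x w + phi c F 2 0 x w) u v = 0))"

definition dual_map :: "'a topology \<Rightarrow> ('a, real^2) chart set \<Rightarrow> ('a \<Rightarrow> (real^5) set) \<Rightarrow>
    ('a \<Rightarrow> (real^5) set) \<Rightarrow> bool" where
  "dual_map X A f f' \<longleftrightarrow>
     (\<forall>x\<in>topspace X. \<exists>U F. x \<in> U \<and> adapted_frame X A f U F \<and> (\<forall>y\<in>U. f' y = ray (column 4 (F y))))"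

text \<open>Here \<open>H\<close> runs through the local smooth lifts of the dual map \<open>f'\<close>.\<close>

definition exceptional :: "'a topology \<Rightarrow> ('a, real^2) chart set \<Rightarrow> ('a \<Rightarrow> (real^5) set) \<Rightarrow>
    ('a \<Rightarrow> real^5) \<Rightarrow> bool" where
  "exceptional X A f N \<longleftrightarrow> (\<exists>f'. dual_map X A f f' \<and>
     (\<forall>U H. openin X U \<longrightarrow> smooth_map A U H \<longrightarrow> (\<forall>x\<in>U. H x \<in> f' x) \<longrightarrow>
        (\<forall>c\<in>A. \<forall>x\<in>U \<inter> dom c. \<forall>v. ip (diff_in c N x v) (diff_in c H x v) = 0)))"

section \<open>The leaf space and the directrix curve\<close>

text \<open>Two points are on the same leaf iff they are joined by a curve tangent to \<open>ker dN\<close>. The velocity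
  of the curve may vanish, so that curves can be concatenated after reparametrization.\<close>

definition kernel_curve :: "'a topology \<Rightarrow> ('a, real^2) chart set \<Rightarrow> ('a \<Rightarrow> real^5) \<Rightarrow> (real \<Rightarrow> 'a) \<Rightarrow> bool" where
  "kernel_curve X A N \<gamma> \<longleftrightarrow> continuous_map (top_of_set {0..1}) X \<gamma> \<and>
     (\<forall>s\<in>{0..1}. \<forall>c\<in>A. \<gamma> s \<in> dom c \<longrightarrow>
        (\<exists>v. ((coord c \<circ> \<gamma>) has_vector_derivative v) (at s within {0..1}) \<and> diff_in c N (\<gamma> s) v = 0))"

definition leaf :: "'a topology \<Rightarrow> ('a, real^2) chart set \<Rightarrow> ('a \<Rightarrow> real^5) \<Rightarrow> 'a \<Rightarrow> 'a set" where
  "leaf X A N x = {y. \<exists>\<gamma>. kernel_curve X A N \<gamma> \<and> \<gamma> 0 = x \<and> \<gamma> 1 = y}"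

text \<open>The set of leaves with the quotient topology; the projection \<open>\<pi>\<close> is \<open>leaf X A N\<close>.\<close>

definition leaf_space :: "'a topology \<Rightarrow> ('a, real^2) chart set \<Rightarrow> ('a \<Rightarrow> real^5) \<Rightarrow> 'a set topology" where
  "leaf_space X A N = topology (\<lambda>W. W \<subseteq> leaf X A N ` topspace X \<and>
     openin X {x \<in> topspace X. leaf X A N x \<in> W})"

lemma openin_leaf_space:
  "openin (leaf_space X A N) W \<longleftrightarrow>
     W \<subseteq> leaf X A N ` topspace X \<and> openin X {x \<in> topspace X. leaf X A N x \<in> W}"
proof -
  have "istopology (\<lambda>W. W \<subseteq> leaf X A N ` topspace X \<and> openin X {x \<in> topspace X. leaf X A N x \<in> W})"
    unfolding istopology_def
  proof (intro conjI allI impI)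
    fix S T
    assume "S \<subseteq> leaf X A N ` topspace X \<and> openin X {x \<in> topspace X. leaf X A N x \<in> S}"
      and "T \<subseteq> leaf X A N ` topspace X \<and> openin X {x \<in> topspace X. leaf X A N x \<in> T}"
    moreover have "{x \<in> topspace X. leaf X A N x \<in> S \<inter> T} =
        {x \<in> topspace X. leaf X A N x \<in> S} \<inter> {x \<in> topspace X. leaf X A N x \<in> T}"
      by auto
    ultimately show "S \<inter> T \<subseteq> leaf X A N ` topspace X"
      and "openin X {x \<in> topspace X. leaf X A N x \<in> S \<inter> T}"
      by auto
  next
    fix K
    assume K: "\<forall>W\<in>K. W \<subseteq> leaf X A N ` topspace X \<and> openin X {x \<in> topspace X. leaf X A N x \<in> W}"
    then show "\<Union>K \<subseteq> leaf X A N ` topspace X"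
      by blast
    have "{x \<in> topspace X. leaf X A N x \<in> \<Union>K} = (\<Union>W\<in>K. {x \<in> topspace X. leaf X A N x \<in> W})"
      by auto
    with K show "openin X {x \<in> topspace X. leaf X A N x \<in> \<Union>K}"
      by auto
  qed
  then show ?thesis
    by (simp add: leaf_space_def topology_inverse')
qed

lemma topspace_leaf_space: "topspace (leaf_space X A N) = leaf X A N ` topspace X"
proof
  show "topspace (leaf_space X A N) \<subseteq> leaf X A N ` topspace X"
    using openin_leaf_space[of X A N] openin_topspace by blast
  have "{x \<in> topspace X. leaf X A N x \<in> leaf X A N ` topspace X} = topspace X"
    by auto
  then have "openin (leaf_space X A N) (leaf X A N ` topspace X)"
    by (simp add: openin_leaf_space)
  then show "leaf X A N ` topspace X \<subseteq> topspace (leaf_space X A N)"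
    by (rule openin_subset)
qed

lemma quotient_map_leaf: "quotient_map X (leaf_space X A N) (leaf X A N)"
  by (auto simp: quotient_map_def openin_leaf_space topspace_leaf_space)

definition regular :: "'a topology \<Rightarrow> ('a, real^2) chart set \<Rightarrow> ('a \<Rightarrow> real^5) \<Rightarrow> bool" where
  "regular X A N \<longleftrightarrow> Hausdorff_space (leaf_space X A N)"

text \<open>\<open>L\<close> is an atlas of the smooth structure of the leaf space, which is determined by the
  requirement that the projection is a submersion.\<close>

definition leaf_manifold :: "'a topology \<Rightarrow> ('a, real^2) chart set \<Rightarrow> ('a \<Rightarrow> real^5) \<Rightarrow>
    ('a set, real) chart set \<Rightarrow> bool" where
  "leaf_manifold X A N L \<longleftrightarrow> smooth_manifold (leaf_space X A N) L \<and>
     (\<forall>d\<in>L. let V = {x \<in> topspace X. leaf X A N x \<in> dom d} in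
        smooth_map A V (coord d \<circ> leaf X A N) \<and>
        (\<forall>c\<in>A. \<forall>x\<in>V \<inter> dom c. \<exists>v. diff_in c (coord d \<circ> leaf X A N) x v \<noteq> 0))"

definition immersed_curve :: "'l topology \<Rightarrow> ('l, real) chart set \<Rightarrow> ('l \<Rightarrow> real^5) \<Rightarrow> bool" where
  "immersed_curve \<Lambda> L \<Gamma> \<longleftrightarrow> \<Gamma> ` topspace \<Lambda> \<subseteq> S22 \<and> smooth_map L (topspace \<Lambda>) \<Gamma> \<and>
     (\<forall>d\<in>L. \<forall>\<tau>\<in>dom d. inj (diff_in d \<Gamma> \<tau>))"

definition directrix_curve :: "'a topology \<Rightarrow> ('a, real^2) chart set \<Rightarrow> ('a \<Rightarrow> real^5) \<Rightarrow>
    ('a set, real) chart set \<Rightarrow> ('a set \<Rightarrow> real^5) \<Rightarrow> bool" where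
  "directrix_curve X A N L \<Gamma> \<longleftrightarrow> immersed_curve (leaf_space X A N) L \<Gamma> \<and>
     (\<forall>x\<in>topspace X. N x = \<Gamma> (leaf X A N x))"

text \<open>The function \<open>H'\<close> with \<open>dH = H' \<zeta>\<close>, for a nowhere zero 1-form \<open>\<zeta>\<close> on a 1-manifold.\<close>

definition deriv_wrt :: "('l, real) chart set \<Rightarrow> (('l, real) chart \<Rightarrow> 'l \<Rightarrow> real \<Rightarrow> real) \<Rightarrow>
    ('l \<Rightarrow> real^5) \<Rightarrow> 'l \<Rightarrow> real^5" where
  "deriv_wrt L \<zeta> H \<tau> =
     (THE D. \<forall>d\<in>L. \<tau> \<in> dom d \<longrightarrow> (\<forall>v. diff_in d H \<tau> v = \<zeta> d \<tau> v *\<^sub>R D))"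

definition biisotropic :: "'l topology \<Rightarrow> ('l, real) chart set \<Rightarrow>
    (('l, real) chart \<Rightarrow> 'l \<Rightarrow> real \<Rightarrow> real) \<Rightarrow> ('l \<Rightarrow> real^5) \<Rightarrow> bool" where
  "biisotropic \<Lambda> L \<zeta> \<Gamma> \<longleftrightarrow> immersed_curve \<Lambda> L \<Gamma> \<and>
     (let \<Gamma>' = deriv_wrt L \<zeta> \<Gamma>; \<Gamma>'' = deriv_wrt L \<zeta> \<Gamma>' in
      \<forall>\<tau>\<in>topspace \<Lambda>. ip (\<Gamma>' \<tau>) (\<Gamma>' \<tau>) = 0 \<and> ip (\<Gamma>'' \<tau>) (\<Gamma>'' \<tau>) = 0 \<and>
        bivector (\<Gamma>' \<tau>) (\<Gamma>'' \<tau>) \<noteq> 0)"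

end

theory Submission
  imports Defs
begin

text \<open>Write \<open>C\<^sub>1, C\<^sub>2, C\<^sub>3\<close> for the first three \<open>\<zeta>\<close>-derivatives of \<open>\<Gamma>\<close>, pulled back to \<open>X\<close>, so that
  \<open>dN = \<theta> C\<^sub>1\<close> and \<open>dC\<^sub>i = \<theta> C\<^sub>i\<^sub>+\<^sub>1\<close> for the nowhere zero form \<open>\<theta> = \<pi>\<^sup>*\<zeta>\<close>. For an adapted frame \<open>F\<close>, \<open>C\<^sub>1\<close> is
  a multiple \<open>u (F\<^sub>1 - F\<^sub>2)\<close>; differentiating its inner products with \<open>F\<close> gives
  \<open>C\<^sub>2 \<equiv> -\<epsilon>u\<^sup>2 (\<lambda> F\<^sub>0 + F\<^sub>4)\<close> modulo \<open>C\<^sub>1\<close>, where \<open>\<phi>\<^sup>1\<^sub>4 + \<phi>\<^sup>2\<^sub>4 = \<lambda> (\<phi>\<^sup>1\<^sub>0 + \<phi>\<^sup>2\<^sub>0)\<close>. Both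
  \<open>\<langle>C\<^sub>2, C\<^sub>2\<rangle>\<close> and \<open>\<langle>dN, dF\<^sub>4\<rangle>\<close> vanish exactly when \<open>\<lambda> = 0\<close>. Conversely, if \<open>C\<^sub>2\<close> is null, then the
  conditions on an adapted frame force \<open>F\<^sub>4\<close> to be a multiple of \<open>C\<^sub>2 + m C\<^sub>1\<close> with
  \<open>3m = - \<langle>F\<^sub>0, C\<^sub>3\<rangle> / \<langle>F\<^sub>0, C\<^sub>2\<rangle>\<close>, and this formula yields an adapted frame from any second order frame.\<close>

section \<open>Closure properties of \<open>k\<close> times differentiable functions\<close>

lemma Ck_on_subset: "Ck_on k f S \<Longrightarrow> T \<subseteq> S \<Longrightarrow> Ck_on k f T"
  by (induction k arbitrary: f) (auto intro: continuous_on_subset)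

text \<open>Because \<open>S\<close> is open, the derivative at a point of \<open>S\<close> depends
  only on nearby values in \<open>S\<close>; agreement therefore passes to every directional
  derivative and the induction continues.\<close>

lemma Ck_on_cong:
  assumes "open S" "\<And>p. p \<in> S \<Longrightarrow> f p = g p" "Ck_on k f S"
  shows "Ck_on k g S"
  using assms(2,3)
proof (induction k arbitrary: f g)
  case 0
  then show ?case using continuous_on_cong[of S S f g] by simp
next
  case (Suc k)
  have d: "(f has_derivative frechet_derivative f (at p)) (at p)" if "p \<in> S" for p
    using Suc.prems(2) that by (simp add: frechet_derivative_works)
  have d': "(g has_derivative frechet_derivative f (at p)) (at p)" if "p \<in> S" for p
    by (rule has_derivative_transform_within_open[OF d[OF that] assms(1) that Suc.prems(1)])
  then have eq: "frechet_derivative f (at p) = frechet_derivative g (at p)" if "p \<in> S" for p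
    using that frechet_derivative_at by blast
  have "Ck_on k (\<lambda>p. frechet_derivative g (at p) v) S" for v
    by (rule Suc.IH[of "\<lambda>p. frechet_derivative f (at p) v"]) (use eq Suc.prems(2) in auto)
  moreover have "\<forall>p\<in>S. g differentiable (at p)"
    using d' differentiableI by blast
  ultimately show ?case by simp
qed

text \<open>\<open>Ck_on\<close> refers to the chosen \<open>frechet_derivative\<close>. Uniqueness
  of derivatives lets an explicit formula \<open>f'\<close> take its place, as the closure rules
  below require.\<close>

lemma Ck_on_SucI:
  assumes "open S" "\<And>p. p \<in> S \<Longrightarrow> (f has_derivative f' p) (at p)"
    and "\<And>v. Ck_on k (\<lambda>p. f' p v) S"
  shows "Ck_on (Suc k) f S"
proof -
  have eq: "f' p = frechet_derivative f (at p)" if "p \<in> S" for p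
    using assms(2)[OF that] by (rule frechet_derivative_at)
  have "Ck_on k (\<lambda>p. frechet_derivative f (at p) v) S" for v
    by (rule Ck_on_cong[OF assms(1) _ assms(3)[of v]]) (simp only: eq)
  moreover have "\<forall>p\<in>S. f differentiable (at p)"
    using assms(2) by (auto intro: differentiableI)
  ultimately show ?thesis by simp
qed

lemma Ck_on_SucD:
  assumes "Ck_on (Suc k) f S"
  shows "p \<in> S \<Longrightarrow> (f has_derivative frechet_derivative f (at p)) (at p)"
    and "Ck_on k (\<lambda>p. frechet_derivative f (at p) v) S"
  using assms by (auto simp: frechet_derivative_works)

lemma Ck_on_Suc_imp: "Ck_on (Suc k) f S \<Longrightarrow> Ck_on k f S"
proof (induction k arbitrary: f)
  case 0
  then have "f differentiable (at p)" if "p \<in> S" for p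
    using that by simp
  then show ?case
    by (auto intro!: continuous_at_imp_continuous_on differentiable_imp_continuous_within)
next
  case (Suc k)
  have "Ck_on (Suc k) (\<lambda>p. frechet_derivative f (at p) v) S" for v
    using Suc.prems by (subst (asm) Ck_on.simps(2)) auto
  then have "\<forall>v. Ck_on k (\<lambda>p. frechet_derivative f (at p) v) S"
    using Suc.IH by blast
  moreover have "\<forall>p\<in>S. f differentiable (at p)"
    using Suc.prems by (subst (asm) Ck_on.simps(2)) auto
  ultimately show ?case by simp
qed

lemma Ck_on_const: "open S \<Longrightarrow> Ck_on k (\<lambda>p. c) S"
proof (induction k arbitrary: c)
  case (Suc k)
  then show ?case by (intro Ck_on_SucI[where f' = "\<lambda>_ _. 0"]) auto
qed simp

lemma Ck_on_add:
  assumes "open S"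
  shows "Ck_on k f S \<Longrightarrow> Ck_on k g S \<Longrightarrow> Ck_on k (\<lambda>p. f p + g p) S"
proof (induction k arbitrary: f g)
  case (Suc k)
  note f = Ck_on_SucD[OF Suc.prems(1)] and g = Ck_on_SucD[OF Suc.prems(2)]
  show ?case
    by (rule Ck_on_SucI[OF assms has_derivative_add[OF f(1) g(1)]]) (auto intro: Suc.IH f(2) g(2))
qed (auto intro: continuous_intros)

text \<open>Each summand of the product rule pairs a derivative, of class \<open>k\<close>, with an
  undifferentiated factor, which \<open>Ck_on_Suc_imp\<close> lowers to class \<open>k\<close>.
  Products, scalings and \<open>ip\<close> are instances.\<close>

lemma Ck_on_bilinear:
  assumes "open S" "bounded_bilinear h"
  shows "Ck_on k f S \<Longrightarrow> Ck_on k g S \<Longrightarrow> Ck_on k (\<lambda>p. h (f p) (g p)) S"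
proof (induction k arbitrary: f g)
  case 0
  then show ?case using bounded_bilinear.continuous_on[OF assms(2)] by auto
next
  case (Suc k)
  note f = Ck_on_SucD[OF Suc.prems(1)] and g = Ck_on_SucD[OF Suc.prems(2)]
  show ?case
    by (rule Ck_on_SucI[OF assms(1) bounded_bilinear.FDERIV[OF assms(2) f(1) g(1)]])
      (auto intro!: Ck_on_add assms(1) Suc.IH f(2) g(2) Ck_on_Suc_imp[OF Suc.prems(1)]
        Ck_on_Suc_imp[OF Suc.prems(2)])
qed

lemma Ck_on_linear:
  assumes "open S" "bounded_linear h"
  shows "Ck_on k f S \<Longrightarrow> Ck_on k (\<lambda>p. h (f p)) S"
proof (induction k arbitrary: f)
  case 0
  then show ?case using bounded_linear.continuous_on[OF assms(2)] by auto
next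
  case (Suc k)
  note f = Ck_on_SucD[OF Suc.prems]
  show ?case
    by (rule Ck_on_SucI[OF assms(1) bounded_linear.has_derivative[OF assms(2) f(1)]])
      (auto intro!: Suc.IH f(2))
qed

lemma Ck_on_inverse:
  fixes f :: "'e::real_normed_vector \<Rightarrow> real"
  assumes "open S" "\<And>p. p \<in> S \<Longrightarrow> f p \<noteq> 0"
  shows "Ck_on k f S \<Longrightarrow> Ck_on k (\<lambda>p. inverse (f p)) S"
proof (induction k)
  case 0
  then show ?case using assms(2) by (auto intro: continuous_intros)
next
  case (Suc k)
  note f = Ck_on_SucD[OF Suc.prems] and IH = Suc.IH[OF Ck_on_Suc_imp[OF Suc.prems]]
  \<comment> \<open>The derivative of \<open>1 / f\<close> is written as a product, sign included,
    so that the bilinear rule and the induction hypothesis cover it.\<close>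
  have "Ck_on k (\<lambda>p. (- 1) * (inverse (f p) * frechet_derivative f (at p) v * inverse (f p))) S" for v
    using assms(1)
    by (intro Ck_on_bilinear[OF _ bounded_bilinear_mult] Ck_on_const IH f(2)) auto
  then show ?case
    by (intro Ck_on_SucI[OF assms(1) Deriv.has_derivative_inverse[OF _ f(1)]]) (auto simp: assms(2))
qed

text \<open>With a real inner function, the outer derivative is multiplication by the vector
  \<open>g' 1\<close>. The chain rule becomes a product, to which the bilinear rule applies in
  \<open>Ck_on_compose\<close>.\<close>

lemma has_derivative_compose_real:
  fixes g :: "real \<Rightarrow> 'b::real_normed_vector"
  assumes "(g has_derivative g') (at (f p))" "(f has_derivative f') (at p)"
  shows "((\<lambda>p. g (f p)) has_derivative (\<lambda>v. f' v *\<^sub>R g' 1)) (at p)"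
proof -
  have "g' (y *\<^sub>R 1) = y *\<^sub>R g' 1" for y
    using has_derivative_linear[OF assms(1)] by (rule linear_scale)
  then have "(\<lambda>v. g' (f' v)) = (\<lambda>v. f' v *\<^sub>R g' 1)"
    by (intro ext) (metis mult.right_neutral real_scaleR_def)
  with has_derivative_compose[OF assms(2), of g g'] assms show ?thesis
    by simp
qed

lemma Ck_on_compose:
  fixes f :: "'e::real_normed_vector \<Rightarrow> real" and g :: "real \<Rightarrow> 'b::real_normed_vector"
  assumes "open S" "f ` S \<subseteq> T"
  shows "Ck_on k f S \<Longrightarrow> Ck_on k g T \<Longrightarrow> Ck_on k (\<lambda>p. g (f p)) S"
proof (induction k arbitrary: g)
  case 0
  then show ?case using continuous_on_compose2[of T g S f] assms(2) by simp
next
  case (Suc k)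
  note f = Ck_on_SucD[OF Suc.prems(1)] and g = Ck_on_SucD[OF Suc.prems(2)]
  let ?g' = "\<lambda>y. frechet_derivative g (at y) 1"
  have D: "((\<lambda>p. g (f p)) has_derivative (\<lambda>v. frechet_derivative f (at p) v *\<^sub>R ?g' (f p))) (at p)"
    if p: "p \<in> S" for p
    by (rule has_derivative_compose_real) (use assms(2) p in \<open>auto intro: f(1) g(1)\<close>)
  show ?case
    by (rule Ck_on_SucI[OF assms(1) D], assumption, rule Ck_on_bilinear[OF assms(1) bounded_bilinear_scaleR f(2)
        Suc.IH[OF Ck_on_Suc_imp[OF Suc.prems(1)] g(2)]])
qed

lemma Ck_on_local:
  assumes "\<And>p. p \<in> S \<Longrightarrow> \<exists>T. open T \<and> p \<in> T \<and> Ck_on k f T"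
  shows "Ck_on k f S"
  using assms
proof (induction k arbitrary: f)
  case 0
  show ?case
    unfolding Ck_on.simps
  proof (rule continuous_at_imp_continuous_on, rule ballI)
    fix p assume "p \<in> S"
    from 0[OF this] obtain T where "open T" "p \<in> T" "Ck_on 0 f T"
      by blast
    then show "isCont f p"
      by (simp add: continuous_on_eq_continuous_at)
  qed
next
  case (Suc k)
  have "f differentiable (at p)" if "p \<in> S" for p
  proof -
    from Suc.prems[OF that] obtain T where "p \<in> T" "Ck_on (Suc k) f T"
      by blast
    then show ?thesis by simp
  qed
  moreover have "Ck_on k (\<lambda>p. frechet_derivative f (at p) v) S" for v
  proof (rule Suc.IH)
    fix p assume "p \<in> S"
    from Suc.prems[OF this] obtain T where "open T" "p \<in> T" "Ck_on (Suc k) f T"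
      by blast
    then show "\<exists>T. open T \<and> p \<in> T \<and> Ck_on k (\<lambda>p. frechet_derivative f (at p) v) T"
      using Ck_on_SucD(2) by blast
  qed
  ultimately show ?case by simp
qed

lemma smooth_on_subset: "smooth_on f S \<Longrightarrow> T \<subseteq> S \<Longrightarrow> smooth_on f T"
  by (auto simp: smooth_on_def intro: Ck_on_subset)

lemma smooth_on_has_derivative:
  assumes "smooth_on f S" "p \<in> S"
  shows "(f has_derivative frechet_derivative f (at p)) (at p)"
proof -
  have "Ck_on (Suc 0) f S" using assms(1) unfolding smooth_on_def by blast
  then show ?thesis using assms(2) by (rule Ck_on_SucD(1))
qed

lemma smooth_on_frechet_derivative:
  assumes "smooth_on f S"
  shows "smooth_on (\<lambda>p. frechet_derivative f (at p) v) S"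
proof -
  have "Ck_on (Suc k) f S" for k using assms unfolding smooth_on_def by blast
  then have "Ck_on k (\<lambda>p. frechet_derivative f (at p) v) S" for k by (rule Ck_on_SucD(2))
  then show ?thesis by (simp add: smooth_on_def)
qed

lemma smooth_on_imp_continuous_on:
  assumes "smooth_on f S"
  shows "continuous_on S f"
proof -
  have "Ck_on 0 f S" using assms unfolding smooth_on_def by blast
  then show ?thesis by simp
qed

section \<open>Calculus in charts\<close>

lemma is_chart_param:
  assumes "is_chart X c"
  shows "x \<in> dom c \<Longrightarrow> param c (coord c x) = x"
    and "p \<in> coord c ` dom c \<Longrightarrow> coord c (param c p) = p"
    and "p \<in> coord c ` (U \<inter> dom c) \<Longrightarrow> param c p \<in> U \<inter> dom c"
    and "dom c \<subseteq> topspace X"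
    and "openin X U \<Longrightarrow> open (coord c ` (U \<inter> dom c))"
    and "inj_on (coord c) (dom c)"
proof -
  have op: "openin X (dom c)" and hm: "homeomorphic_map (subtopology X (dom c)) (top_of_set (coord c ` dom c)) (coord c)"
    and o2: "open (coord c ` dom c)"
    using assms by (auto simp: is_chart_def)
  show sub: "dom c \<subseteq> topspace X" using op by (rule openin_subset)
  then have ts: "topspace (subtopology X (dom c)) = dom c" by auto
  show inj: "inj_on (coord c) (dom c)"
    using homeomorphic_imp_injective_map[OF hm] ts by simp
  then show "x \<in> dom c \<Longrightarrow> param c (coord c x) = x"
    and "p \<in> coord c ` dom c \<Longrightarrow> coord c (param c p) = p"
    by (auto simp: f_inv_into_f)
  show "p \<in> coord c ` (U \<inter> dom c) \<Longrightarrow> param c p \<in> U \<inter> dom c"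
    using inj by auto
  assume U: "openin X U"
  then have "openin (subtopology X (dom c)) (U \<inter> dom c)"
    by (auto simp: openin_subtopology)
  then have "openin (top_of_set (coord c ` dom c)) (coord c ` (U \<inter> dom c))"
    using homeomorphic_map_openness[OF hm, of "U \<inter> dom c"] ts by auto
  then show "open (coord c ` (U \<inter> dom c))"
    using o2 by (rule openin_open_trans)
qed

lemma smooth_map_subset:
  assumes "smooth_map A U H" "W \<subseteq> U"
  shows "smooth_map A W H"
  unfolding smooth_map_def
proof
  fix c assume "c \<in> A"
  then have "smooth_on (H \<circ> param c) (coord c ` (U \<inter> dom c))"
    using assms(1) by (simp add: smooth_map_def)
  then show "smooth_on (H \<circ> param c) (coord c ` (W \<inter> dom c))"
    by (rule smooth_on_subset) (use assms(2) in auto)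
qed

lemma bounded_bilinear_ip: "bounded_bilinear ip"
  by (rule bilinear_conv_bounded_bilinear[THEN iffD1])
    (auto simp: bilinear_def ip_def algebra_simps intro!: linearI)

text \<open>The model space \<open>'e\<close> is left open so that one calculus serves both the
  surface (\<open>real^2\<close>) and the leaf space (\<open>real\<close>).\<close>

locale manifold =
  fixes X :: "'a topology" and A :: "('a, 'e::euclidean_space) chart set"
  assumes manifold: "smooth_manifold X A"
begin

lemma chart: "c \<in> A \<Longrightarrow> is_chart X c"
  using manifold by (simp add: smooth_manifold_def)

lemmas param_coord = is_chart_param(1)[OF chart]
  and coord_param = is_chart_param(2)[OF chart]
  and param_in = is_chart_param(3)[OF chart]
  and dom_subset = is_chart_param(4)[OF chart]
  and open_coord = is_chart_param(5)[OF chart]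

lemma openin_dom: "c \<in> A \<Longrightarrow> openin X (dom c)"
  using chart by (simp add: is_chart_def)

lemma obtain_chart:
  assumes "x \<in> topspace X"
  obtains c where "c \<in> A" "x \<in> dom c"
proof -
  have "x \<in> (\<Union>c\<in>A. dom c)" using manifold assms by (simp add: smooth_manifold_def)
  then show ?thesis using that by blast
qed

lemma has_derivative_diff_in:
  assumes "c \<in> A" "smooth_map A U H" "x \<in> U" "x \<in> dom c"
  shows "((\<lambda>p. H (param c p)) has_derivative diff_in c H x) (at (coord c x))"
proof -
  have "diff_in c H x = frechet_derivative (H \<circ> param c) (at (coord c x))"
    by (simp add: diff_in_def fun_eq_iff)
  moreover have "smooth_on (H \<circ> param c) (coord c ` (U \<inter> dom c))"
    using assms(1,2) by (simp add: smooth_map_def)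
  ultimately show ?thesis
    using smooth_on_has_derivative[of "H \<circ> param c" "coord c ` (U \<inter> dom c)" "coord c x"] assms(3,4)
    by (simp add: o_def)
qed

lemma linear_diff_in:
  assumes "c \<in> A" "smooth_map A U H" "x \<in> U" "x \<in> dom c"
  shows "linear (diff_in c H x)"
  using has_derivative_diff_in[OF assms] by (rule has_derivative_linear)

lemma diff_in_eqI:
  assumes "((\<lambda>p. H (param c p)) has_derivative D) (at (coord c x))"
  shows "diff_in c H x v = D v"
  using frechet_derivative_at[OF assms] by (simp add: diff_in_def o_def)

lemma diff_in_cong:
  assumes "c \<in> A" "openin X U" "x \<in> U" "x \<in> dom c" "smooth_map A U H" "\<And>y. y \<in> U \<Longrightarrow> H y = K y"
  shows "diff_in c K x v = diff_in c H x v"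
proof (rule diff_in_eqI)
  show "((\<lambda>p. K (param c p)) has_derivative diff_in c H x) (at (coord c x))"
    by (rule has_derivative_transform_within_open[OF
          has_derivative_diff_in[OF assms(1,5,3,4)] open_coord[OF assms(1,2)]])
      (use assms param_in[OF assms(1)] in auto)
qed

lemma diff_in_bilinear:
  assumes "c \<in> A" "x \<in> U" "x \<in> dom c" "bounded_bilinear h" "smooth_map A U H" "smooth_map A U K"
  shows "diff_in c (\<lambda>y. h (H y) (K y)) x v = h (H x) (diff_in c K x v) + h (diff_in c H x v) (K x)"
  using bounded_bilinear.FDERIV[OF assms(4) has_derivative_diff_in[OF assms(1,5,2,3)]
      has_derivative_diff_in[OF assms(1,6,2,3)]] param_coord[OF assms(1,3)]
  by (intro diff_in_eqI) simp

lemma diff_in_linear: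
  assumes "c \<in> A" "x \<in> U" "x \<in> dom c" "bounded_linear h" "smooth_map A U H"
  shows "diff_in c (\<lambda>y. h (H y)) x v = h (diff_in c H x v)"
  by (rule diff_in_eqI) (rule bounded_linear.has_derivative[OF assms(4) has_derivative_diff_in[OF assms(1,5,2,3)]])

text \<open>The Leibniz rule for a constant inner product: all relations between frames and
  derivatives of the directrix come from it.\<close>

lemma diff_in_ip_const:
  assumes "c \<in> A" "openin X U" "x \<in> U" "x \<in> dom c" "smooth_map A U H" "smooth_map A U K"
    and "\<And>y. y \<in> U \<Longrightarrow> ip (H y) (K y) = a"
  shows "ip (diff_in c H x v) (K x) + ip (H x) (diff_in c K x v) = 0"
proof -
  have "((\<lambda>p. ip (H (param c p)) (K (param c p))) has_derivative (\<lambda>v. 0)) (at (coord c x))"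
    by (rule has_derivative_transform_within_open[OF has_derivative_const open_coord[OF assms(1,2)]])
      (use assms param_in[OF assms(1)] in auto)
  then show ?thesis
    using diff_in_eqI[of "\<lambda>y. ip (H y) (K y)" c] diff_in_bilinear[OF assms(1,3,4) bounded_bilinear_ip assms(5,6)]
    by (simp add: add.commute)
qed

lemma smooth_mapI:
  assumes "\<And>c k. c \<in> A \<Longrightarrow> open (coord c ` (U \<inter> dom c)) \<Longrightarrow> Ck_on k (\<lambda>p. H (param c p)) (coord c ` (U \<inter> dom c))"
    and "openin X U"
  shows "smooth_map A U H"
  using assms open_coord by (auto simp: smooth_map_def smooth_on_def o_def)

lemma smooth_mapD:
  "smooth_map A U H \<Longrightarrow> c \<in> A \<Longrightarrow> Ck_on k (\<lambda>p. H (param c p)) (coord c ` (U \<inter> dom c))"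
  by (auto simp: smooth_map_def smooth_on_def o_def)

lemma smooth_map_cong:
  assumes "openin X U" "smooth_map A U H" "\<And>y. y \<in> U \<Longrightarrow> H y = K y"
  shows "smooth_map A U K"
  by (intro smooth_mapI assms(1), rule Ck_on_cong[OF _ _ smooth_mapD[OF assms(2)]])
    (use assms(3) param_in in auto)

lemma smooth_map_const: "openin X U \<Longrightarrow> smooth_map A U (\<lambda>x. k)"
  by (intro smooth_mapI Ck_on_const)

lemma smooth_map_bilinear:
  assumes "openin X U" "bounded_bilinear h" "smooth_map A U H" "smooth_map A U K"
  shows "smooth_map A U (\<lambda>y. h (H y) (K y))"
  by (intro smooth_mapI assms(1) Ck_on_bilinear[OF _ assms(2)] smooth_mapD[OF assms(3)] smooth_mapD[OF assms(4)])

lemma smooth_map_linear: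
  assumes "openin X U" "bounded_linear h" "smooth_map A U H"
  shows "smooth_map A U (\<lambda>y. h (H y))"
  by (intro smooth_mapI assms(1) Ck_on_linear[OF _ assms(2)] smooth_mapD[OF assms(3)])

lemma smooth_map_add:
  assumes "openin X U" "smooth_map A U H" "smooth_map A U K"
  shows "smooth_map A U (\<lambda>y. H y + K y)"
  by (intro smooth_mapI assms(1) Ck_on_add smooth_mapD[OF assms(2)] smooth_mapD[OF assms(3)])

lemma smooth_map_inverse:
  fixes H :: "'a \<Rightarrow> real"
  assumes "openin X U" "smooth_map A U H" "\<And>y. y \<in> U \<Longrightarrow> H y \<noteq> 0"
  shows "smooth_map A U (\<lambda>y. inverse (H y))"
  by (intro smooth_mapI assms(1) Ck_on_inverse smooth_mapD[OF assms(2)])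
    (use assms(3) param_in in auto)

lemma smooth_map_compose:
  fixes H :: "'a \<Rightarrow> real"
  assumes "openin X U" "smooth_map A U H" "\<And>y. y \<in> U \<Longrightarrow> H y \<in> T" "smooth_on g T"
  shows "smooth_map A U (\<lambda>y. g (H y))"
proof (intro smooth_mapI assms(1))
  fix c k assume c: "c \<in> A" and o: "open (coord c ` (U \<inter> dom c))"
  show "Ck_on k (\<lambda>p. g (H (param c p))) (coord c ` (U \<inter> dom c))"
    by (rule Ck_on_compose[OF o _ smooth_mapD[OF assms(2) c], of T])
      (use assms(3,4) param_in[OF c] in \<open>auto simp: smooth_on_def\<close>)
qed

lemma diff_in_compose:
  fixes H :: "'a \<Rightarrow> real"
  assumes "c \<in> A" "x \<in> U" "x \<in> dom c" "smooth_map A U H" "H x \<in> T" "smooth_on g T"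
  shows "diff_in c (\<lambda>y. g (H y)) x v = diff_in c H x v *\<^sub>R frechet_derivative g (at (H x)) 1"
proof (rule diff_in_eqI, rule has_derivative_compose_real)
  show "(g has_derivative frechet_derivative g (at (H x))) (at (H (param c (coord c x))))"
    using smooth_on_has_derivative[OF assms(6,5)] param_coord[OF assms(1,3)] by simp
qed (rule has_derivative_diff_in[OF assms(1,4,2,3)])

lemma smooth_map_diff:
  assumes "openin X U" "smooth_map A U H" "smooth_map A U K"
  shows "smooth_map A U (\<lambda>y. H y - K y)"
  using smooth_map_add[OF assms(1,2) smooth_map_linear[OF assms(1) bounded_linear_minus[OF bounded_linear_ident] assms(3)]]
  by simp

lemma smooth_map_mult:
  fixes H K :: "'a \<Rightarrow> real"
  assumes "openin X U" "smooth_map A U H" "smooth_map A U K"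
  shows "smooth_map A U (\<lambda>y. H y * K y)"
  by (rule smooth_map_bilinear[OF assms(1) bounded_bilinear_mult assms(2,3)])

lemma smooth_map_divide:
  fixes H K :: "'a \<Rightarrow> real"
  assumes "openin X U" "smooth_map A U H" "smooth_map A U K" "\<And>y. y \<in> U \<Longrightarrow> K y \<noteq> 0"
  shows "smooth_map A U (\<lambda>y. H y / K y)"
  unfolding divide_inverse by (intro smooth_map_mult smooth_map_inverse assms)

lemma smooth_map_ip:
  assumes "openin X U" "smooth_map A U H" "smooth_map A U K"
  shows "smooth_map A U (\<lambda>y. ip (H y) (K y))"
  by (rule smooth_map_bilinear[OF assms(1) bounded_bilinear_ip assms(2,3)])

text \<open>A vector is the finite sum of its components placed on the axes, and each placement is
  linear.\<close>

lemma smooth_map_vec_lambda: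
  fixes H :: "'a \<Rightarrow> 'i::finite \<Rightarrow> 'b::euclidean_space"
  assumes "openin X U" "\<And>i. smooth_map A U (\<lambda>y. H y i)"
  shows "smooth_map A U (\<lambda>y. \<chi> i. H y i)"
proof -
  have "smooth_map A U (\<lambda>y. \<Sum>i\<in>S. axis i (H y i))" if "finite S" for S
    using that
  proof (induction S rule: finite_induct)
    case empty
    then show ?case by (simp add: smooth_map_const assms(1))
  next
    case (insert j S)
    have "bounded_linear (axis j :: 'b \<Rightarrow> 'b ^ 'i)"
      by (intro linear_conv_bounded_linear[THEN iffD1] linearI) (auto simp: axis_def vec_eq_iff)
    then have "smooth_map A U (\<lambda>y. axis j (H y j))"
      using assms(2) by (rule smooth_map_linear[OF assms(1)])
    with insert show ?case
      by (simp add: smooth_map_add[OF assms(1)])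
  qed
  from this[OF finite[of "UNIV :: 'i set"]] show ?thesis
    by (rule smooth_map_cong[OF assms(1)]) (simp add: vec_eq_iff axis_def if_distrib cong: if_cong)
qed

text \<open>Continuity of \<open>H\<close> is known only through charts, so openness is checked near
  each point, inside one chart domain. It serves to shrink a domain until certain signs are
  constant.\<close>

lemma openin_smooth_preimage:
  assumes "openin X U" "smooth_map A U H" "open T"
  shows "openin X {y \<in> U. H y \<in> T}"
proof (subst openin_subopen, safe)
  fix x assume x: "x \<in> U" "H x \<in> T"
  then have "x \<in> topspace X" using assms(1) openin_subset by blast
  then obtain c where c: "c \<in> A" "x \<in> dom c" using obtain_chart by blast
  let ?S = "coord c ` (U \<inter> dom c)"
  have hm: "homeomorphic_map (subtopology X (dom c)) (top_of_set (coord c ` dom c)) (coord c)"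
    using chart[OF c(1)] by (simp add: is_chart_def)
  have "continuous_on ?S (H \<circ> param c)"
    using assms(2) c(1) by (intro smooth_on_imp_continuous_on) (simp add: smooth_map_def)
  then have o: "open (?S \<inter> (H \<circ> param c) -` T)"
    using open_coord[OF c(1) assms(1)] assms(3) by (rule continuous_open_preimage)
  have eq: "{y \<in> topspace (subtopology X (dom c)). coord c y \<in> ?S \<inter> (H \<circ> param c) -` T} = {y \<in> U \<inter> dom c. H y \<in> T}"
  proof -
    have S: "coord c y \<in> ?S \<longleftrightarrow> y \<in> U \<inter> dom c" if "y \<in> dom c" for y
      using inj_on_image_mem_iff[OF is_chart_param(6)[OF chart[OF c(1)]] that, of "U \<inter> dom c"] by simp
    have "topspace (subtopology X (dom c)) = dom c"
      using dom_subset[OF c(1)] by auto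
    moreover have "y \<in> dom c \<and> coord c y \<in> ?S \<inter> (H \<circ> param c) -` T \<longleftrightarrow> y \<in> U \<inter> dom c \<and> H y \<in> T" for y
      by (cases "y \<in> dom c") (simp_all add: S param_coord[OF c(1)])
    ultimately show ?thesis
      by simp
  qed
  have "continuous_map (subtopology X (dom c)) (top_of_set (coord c ` dom c)) (coord c)"
    using hm by (rule homeomorphic_imp_continuous_map)
  moreover have "openin (top_of_set (coord c ` dom c)) (?S \<inter> (H \<circ> param c) -` T)"
    using o chart[OF c(1)] by (intro open_openin_trans) (auto simp: is_chart_def)
  ultimately have "openin (subtopology X (dom c)) {y \<in> U \<inter> dom c. H y \<in> T}"
    unfolding eq[symmetric] by (rule openin_continuous_map_preimage)
  then have "openin X {y \<in> U \<inter> dom c. H y \<in> T}"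
    using openin_dom[OF c(1)] by (simp add: openin_trans_full)
  then show "\<exists>W. openin X W \<and> x \<in> W \<and> W \<subseteq> {y \<in> U. H y \<in> T}"
    using x c(2) by (intro exI[of _ "{y \<in> U \<inter> dom c. H y \<in> T}"]) auto
qed

text \<open>This is the chain rule for \<open>coord d \<circ> param c\<close>; it makes derivatives
  with respect to a form independent of the chart.\<close>

lemma diff_in_chart_change:
  assumes "c \<in> A" "d \<in> A" "openin X U" "x \<in> U" "x \<in> dom c" "x \<in> dom d" "smooth_map A U H"
  shows "diff_in c H x v = diff_in d H x (diff_in c (coord d) x v)"
proof (rule diff_in_eqI)
  have tr: "smooth_on (coord d \<circ> param c) (coord c ` (dom c \<inter> dom d))"
    using manifold assms(1,2) by (simp add: smooth_manifold_def)
  have t: "((\<lambda>p. coord d (param c p)) has_derivative diff_in c (coord d) x) (at (coord c x))"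
  proof -
    have "diff_in c (coord d) x = frechet_derivative (coord d \<circ> param c) (at (coord c x))"
      by (simp add: diff_in_def fun_eq_iff)
    then show ?thesis
      using smooth_on_has_derivative[OF tr, of "coord c x"] assms(5,6) by (simp add: o_def)
  qed
  have "((\<lambda>p. H (param d (coord d (param c p)))) has_derivative
      (\<lambda>v. diff_in d H x (diff_in c (coord d) x v))) (at (coord c x))"
    using has_derivative_compose[OF t] has_derivative_diff_in[OF assms(2,7,4,6)] param_coord[OF assms(1,5)]
    by simp
  then show "((\<lambda>p. H (param c p)) has_derivative (\<lambda>v. diff_in d H x (diff_in c (coord d) x v))) (at (coord c x))"
    by (rule has_derivative_transform_within_open[OF _ open_coord[OF assms(1) openin_dom[OF assms(2)]]])
      (use assms param_in[OF assms(1)] param_coord[OF assms(2)] in auto)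
qed

lemma smooth_map_local:
  assumes "openin X U" "\<And>x. x \<in> U \<Longrightarrow> \<exists>W. x \<in> W \<and> openin X W \<and> smooth_map A W H"
  shows "smooth_map A U H"
proof (intro smooth_mapI assms(1) Ck_on_local)
  fix c k p assume c: "c \<in> A" and "p \<in> coord c ` (U \<inter> dom c)"
  then obtain x where x: "x \<in> U" "x \<in> dom c" "p = coord c x" by auto
  obtain W where W: "x \<in> W" "openin X W" "smooth_map A W H"
    using assms(2)[OF x(1)] by blast
  show "\<exists>T. open T \<and> p \<in> T \<and> Ck_on k (\<lambda>p. H (param c p)) T"
    by (rule exI[of _ "coord c ` (W \<inter> dom c)"])
      (use open_coord[OF c W(2)] x W(1) smooth_mapD[OF W(3) c] in auto)
qed

end

section \<open>Frames\<close>

lemma UNIV_5: "(UNIV :: 5 set) = {0, 1, 2, 3, 4}"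
proof -
  have "x \<in> {0, 1, 2, 3, 4}" for x :: 5
  proof (induct x)
    case (of_int z)
    then have "0 \<le> z" and "z < 5" by simp_all
    then have "z = 0 \<or> z = 1 \<or> z = 2 \<or> z = 3 \<or> z = 4" by arith
    then show ?case by auto
  qed
  then show ?thesis by auto
qed

lemma sum_5: "sum f (UNIV :: 5 set) = f 0 + f 1 + f 2 + f 3 + f 4"
  unfolding UNIV_5 by (simp add: add.assoc)

lemma all_5: "(\<forall>i::5. P i) \<longleftrightarrow> P 0 \<and> P 1 \<and> P 2 \<and> P 3 \<and> P 4"
proof -
  have "(\<forall>i::5. P i) \<longleftrightarrow> (\<forall>i\<in>{0, 1, 2, 3, 4}. P i)"
    unfolding UNIV_5[symmetric] by simp
  then show ?thesis by simp
qed

lemma ip_commute: "ip V W = ip W V"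
  by (simp add: ip_def)

lemmas ip_linear [simp] =
  bounded_bilinear.add_left[OF bounded_bilinear_ip] bounded_bilinear.add_right[OF bounded_bilinear_ip]
  bounded_bilinear.diff_left[OF bounded_bilinear_ip] bounded_bilinear.diff_right[OF bounded_bilinear_ip]
  bounded_bilinear.minus_left[OF bounded_bilinear_ip] bounded_bilinear.minus_right[OF bounded_bilinear_ip]
  bounded_bilinear.scaleR_left[OF bounded_bilinear_ip] bounded_bilinear.scaleR_right[OF bounded_bilinear_ip]
  bounded_bilinear.zero_left[OF bounded_bilinear_ip] bounded_bilinear.zero_right[OF bounded_bilinear_ip]

lemma ip_axis:
  "ip V (axis 0 1) = - V$4" "ip V (axis 1 1) = - V$1" "ip V (axis 2 1) = V$2"
  "ip V (axis 3 1) = V$3" "ip V (axis 4 1) = - V$0"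
  by (simp_all add: ip_def axis_def)

lemma column_conv: "column j M = M *v axis j 1" for M :: "real^'n^'m"
  by (simp add: matrix_vector_mult_basis)

context
  fixes F :: "real^5^5"
  assumes F: "F \<in> isometries"
begin

lemma isometry_ip: "ip (F *v V) (F *v W) = ip V W"
  using F by (simp add: isometries_def)

lemma frame_ip:
  "ip (column 0 F) (column 0 F) = 0" "ip (column 0 F) (column 1 F) = 0" "ip (column 0 F) (column 2 F) = 0"
  "ip (column 0 F) (column 3 F) = 0" "ip (column 0 F) (column 4 F) = - 1"
  "ip (column 1 F) (column 0 F) = 0" "ip (column 1 F) (column 1 F) = - 1" "ip (column 1 F) (column 2 F) = 0"
  "ip (column 1 F) (column 3 F) = 0" "ip (column 1 F) (column 4 F) = 0"
  "ip (column 2 F) (column 0 F) = 0" "ip (column 2 F) (column 1 F) = 0" "ip (column 2 F) (column 2 F) = 1"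
  "ip (column 2 F) (column 3 F) = 0" "ip (column 2 F) (column 4 F) = 0"
  "ip (column 3 F) (column 0 F) = 0" "ip (column 3 F) (column 1 F) = 0" "ip (column 3 F) (column 2 F) = 0"
  "ip (column 3 F) (column 3 F) = 1" "ip (column 3 F) (column 4 F) = 0"
  "ip (column 4 F) (column 0 F) = - 1" "ip (column 4 F) (column 1 F) = 0" "ip (column 4 F) (column 2 F) = 0"
  "ip (column 4 F) (column 3 F) = 0" "ip (column 4 F) (column 4 F) = 0"
  unfolding column_conv isometry_ip by (simp_all add: ip_def axis_def)

text \<open>A vector in the kernel of \<open>F\<close> is orthogonal to everything, hence zero
  because \<open>ip\<close> is nondegenerate.\<close>

lemma isometry_invertible: "invertible F"
proof -
  have "V = 0" if "F *v V = 0" for V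
  proof -
    have "ip V W = 0" for W
      using isometry_ip[of V W] that by simp
    from this[of "axis 0 1"] this[of "axis 1 1"] this[of "axis 2 1"] this[of "axis 3 1"] this[of "axis 4 1"]
    show ?thesis
      by (simp add: vec_eq_iff all_5 ip_axis)
  qed
  then show ?thesis
    by (auto simp: invertible_left_inverse matrix_left_invertible_ker)
qed

lemma matrix_inv_frame: "F ** matrix_inv F = mat 1"
  using isometry_invertible unfolding invertible_def matrix_inv_def by (rule someI2_ex) simp

text \<open>The columns have the same Gram matrix as the standard basis. Columns 0 and 4 are null
  and pair to -1, so each reads off the coefficient of the other with a minus sign; column 1 has
  square -1.\<close>

lemma frame_coefficients:
  "(matrix_inv F *v W) $ 0 = - ip (column 4 F) W" "(matrix_inv F *v W) $ 1 = - ip (column 1 F) W"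
  "(matrix_inv F *v W) $ 2 = ip (column 2 F) W" "(matrix_inv F *v W) $ 3 = ip (column 3 F) W"
  "(matrix_inv F *v W) $ 4 = - ip (column 0 F) W"
proof -
  have "W = F *v (matrix_inv F *v W)"
    using matrix_inv_frame by (simp add: matrix_vector_mul_assoc)
  then have "ip (column j F) W = ip (matrix_inv F *v W) (axis j 1)" for j
    unfolding column_conv by (metis isometry_ip ip_commute)
  then show "(matrix_inv F *v W) $ 0 = - ip (column 4 F) W" "(matrix_inv F *v W) $ 1 = - ip (column 1 F) W"
  "(matrix_inv F *v W) $ 2 = ip (column 2 F) W" "(matrix_inv F *v W) $ 3 = ip (column 3 F) W"
  "(matrix_inv F *v W) $ 4 = - ip (column 0 F) W"
    by (simp_all add: ip_axis)
qed

lemma ip_expand: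
  "ip V W = - ip (column 0 F) V * ip (column 4 F) W - ip (column 4 F) V * ip (column 0 F) W
     - ip (column 1 F) V * ip (column 1 F) W + ip (column 2 F) V * ip (column 2 F) W
     + ip (column 3 F) V * ip (column 3 F) W"
proof -
  have "U = F *v (matrix_inv F *v U)" for U
    using matrix_inv_frame by (simp add: matrix_vector_mul_assoc)
  then have "ip V W = ip (matrix_inv F *v V) (matrix_inv F *v W)"
    by (metis isometry_ip)
  then show ?thesis
    by (simp add: ip_def[of "_ *v _"] frame_coefficients)
qed

lemma frame_eqI:
  assumes "\<And>j. ip (column j F) V = ip (column j F) W"
  shows "V = W"
proof -
  have "matrix_inv F *v V = matrix_inv F *v W"
    by (simp add: vec_eq_iff all_5 frame_coefficients assms)
  then have "F *v (matrix_inv F *v V) = F *v (matrix_inv F *v W)" by simp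
  then show ?thesis
    using matrix_inv_frame by (simp add: matrix_vector_mul_assoc)
qed

end

lemma G23_isometries: "F \<in> G23 \<Longrightarrow> F \<in> isometries"
  unfolding G23_def using connected_component_subset by blast

lemma isometries_mult: "F \<in> isometries \<Longrightarrow> g \<in> isometries \<Longrightarrow> F ** g \<in> isometries"
  by (simp add: isometries_def flip: matrix_vector_mul_assoc)

text \<open>The change of frames \<open>F\<^sub>0 \<mapsto> r F\<^sub>0\<close>, \<open>F\<^sub>1 - F\<^sub>2 \<mapsto> s (F\<^sub>1 - F\<^sub>2 + a F\<^sub>0)\<close>,
  \<open>F\<^sub>1 + F\<^sub>2 \<mapsto> s\<^sup>-\<^sup>1 (F\<^sub>1 + F\<^sub>2 + b F\<^sub>0)\<close>, \<open>F\<^sub>3 \<mapsto> F\<^sub>3\<close>.\<close>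

definition gauge :: "real \<Rightarrow> real \<Rightarrow> real \<Rightarrow> real \<Rightarrow> real^5^5" where
  "gauge r s a b = (\<chi> i j.
     if j = 0 then (if i = 0 then r else 0)
     else if j = 1 then (if i = 0 then (s * a + b / s) / 2 else if i = 1 then (s + 1 / s) / 2
       else if i = 2 then (1 / s - s) / 2 else 0)
     else if j = 2 then (if i = 0 then (b / s - s * a) / 2 else if i = 1 then (1 / s - s) / 2
       else if i = 2 then (s + 1 / s) / 2 else 0)
     else if j = 3 then (if i = 3 then 1 else 0)
     else (if i = 0 then - a * b / (2 * r) else if i = 1 then - (a + b) / (2 * r)
       else if i = 2 then (b - a) / (2 * r) else if i = 4 then 1 / r else 0))"

lemma isometriesI:
  assumes "\<And>i j. ip (column i M) (column j M) = ip (axis i 1) (axis j 1)"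
  shows "M \<in> isometries"
proof -
  interpret ip: bounded_bilinear ip by (rule bounded_bilinear_ip)
  have "ip (M *v V) (M *v W) = (\<Sum>i\<in>UNIV. \<Sum>j\<in>UNIV. V $ i * W $ j * ip (axis i 1) (axis j 1))" for V W
    unfolding matrix_mult_sum[of M] scalar_mult_eq_scaleR
    by (simp only: ip.sum_left ip.sum_right ip_linear assms) (simp add: sum_5 algebra_simps)
  then show ?thesis
    by (simp add: isometries_def sum_5 ip_def axis_def)
qed

lemma gauge_isometry:
  assumes "r \<noteq> 0" "s \<noteq> 0"
  shows "gauge r s a b \<in> isometries"
proof (rule isometriesI)
  fix i j :: 5
  have "\<forall>i j :: 5. ip (column i (gauge r s a b)) (column j (gauge r s a b)) = ip (axis i 1) (axis j 1)"
    unfolding all_5 using assms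
    by (intro conjI; simp add: ip_def axis_def column_def gauge_def; simp add: field_simps)
  then show "ip (column i (gauge r s a b)) (column j (gauge r s a b)) = ip (axis i 1) (axis j 1)"
    by blast
qed

lemma continuous_on_gauge:
  assumes "continuous_on S r" "continuous_on S s" "continuous_on S a" "continuous_on S b"
    and "\<And>t. t \<in> S \<Longrightarrow> r t \<noteq> 0" "\<And>t. t \<in> S \<Longrightarrow> s t \<noteq> 0"
  shows "continuous_on S (\<lambda>t. gauge (r t) (s t) (a t) (b t) $ i $ j)"
proof -
  have "\<forall>i j. continuous_on S (\<lambda>t. gauge (r t) (s t) (a t) (b t) $ i $ j)"
    unfolding all_5 gauge_def
    by (simp add: continuous_on_const assms(1))
      (intro conjI continuous_on_divide continuous_on_add continuous_on_diff continuous_on_minus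
        continuous_on_mult continuous_on_const assms(1-4); simp add: assms(5,6))
  then show ?thesis by blast
qed

lemma gauge_id: "gauge 1 1 0 0 = mat 1"
  by (simp add: gauge_def mat_def vec_eq_iff all_5)

lemma column_gauge:
  "column 0 (F ** gauge r s a b) = r *\<^sub>R column 0 F"
  "column 1 (F ** gauge r s a b) = ((s * a + b / s) / 2) *\<^sub>R column 0 F + ((s + 1 / s) / 2) *\<^sub>R column 1 F
     + ((1 / s - s) / 2) *\<^sub>R column 2 F"
  "column 2 (F ** gauge r s a b) = ((b / s - s * a) / 2) *\<^sub>R column 0 F + ((1 / s - s) / 2) *\<^sub>R column 1 F
     + ((s + 1 / s) / 2) *\<^sub>R column 2 F"
  "column 3 (F ** gauge r s a b) = column 3 F"
  "column 4 (F ** gauge r s a b) = (- a * b / (2 * r)) *\<^sub>R column 0 F + (- (a + b) / (2 * r)) *\<^sub>R column 1 F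
     + ((b - a) / (2 * r)) *\<^sub>R column 2 F + (1 / r) *\<^sub>R column 4 F"
  by (simp_all add: vec_eq_iff column_def matrix_matrix_mult_def sum_5 gauge_def mult.commute)

text \<open>Positivity of \<open>r\<close> and \<open>s\<close> allows the parameters to be moved
  linearly from \<open>(1, 1, 0, 0)\<close> to \<open>(r, s, a, b)\<close>. The resulting path of
  isometries starts at \<open>F\<close>, so its end lies in the same component.\<close>

lemma G23_gauge:
  assumes "F \<in> G23" "r > 0" "s > 0"
  shows "F ** gauge r s a b \<in> G23"
proof -
  define P where "P t = F ** gauge (1 + t * (r - 1)) (1 + t * (s - 1)) (t * a) (t * b)" for t :: real
  have pos: "1 + t * (x - 1) > 0" if "t \<in> {0..1}" "x > 0" for t x :: real
  proof -
    have "1 + t * (x - 1) = (1 - t) + t * x" by (simp add: algebra_simps)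
    moreover have "(1 - t) + t * x > 0"
      using that by (cases "t = 0") (auto intro: add_nonneg_pos)
    ultimately show ?thesis by simp
  qed
  have nz: "1 + t * (r - 1) \<noteq> 0" "1 + t * (s - 1) \<noteq> 0" if "t \<in> {0..1}" for t
    using pos[OF that assms(2)] pos[OF that assms(3)] by auto
  have cont: "continuous_on {0..1} (\<lambda>t. gauge (1 + t * (r - 1)) (1 + t * (s - 1)) (t * a) (t * b) $ i $ j)" for i j
    by (intro continuous_on_gauge continuous_intros nz)
  have "continuous_on {0..1} P"
    unfolding P_def matrix_matrix_mult_def by (intro continuous_on_vec_lambda continuous_on_sum continuous_on_mult continuous_on_const cont)
  then have con: "connected (P ` {0..1})"
    by (rule connected_continuous_image) simp
  have iso: "P ` {0..1} \<subseteq> isometries"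
    unfolding P_def using nz G23_isometries[OF assms(1)] by (auto intro!: isometries_mult gauge_isometry)
  have "P 0 = F" by (simp add: P_def gauge_id)
  then have "F \<in> P ` {0..1}" by force
  then have "P ` {0..1} \<subseteq> connected_component_set isometries F"
    using con iso by (rule connected_component_maximal)
  also have "\<dots> = G23"
    using assms(1) unfolding G23_def by (simp add: connected_component_eq)
  finally have "P 1 \<in> G23" by auto
  then show ?thesis by (simp add: P_def)
qed

section \<open>Differentiation along the leaf space\<close>

locale curve_manifold = manifold X L for X :: "'l topology" and L :: "('l, real) chart set" +
  fixes \<zeta> :: "('l, real) chart \<Rightarrow> 'l \<Rightarrow> real \<Rightarrow> real"
  assumes zeta: "nowhere_zero_one_form L \<zeta>"
begin

lemma zeta_scale:
  assumes "d \<in> L" "\<tau> \<in> dom d"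
  shows "\<zeta> d \<tau> v = v * \<zeta> d \<tau> 1"
proof -
  have "linear (\<zeta> d \<tau>)"
    using zeta assms by (simp add: nowhere_zero_one_form_def one_form_def)
  from linear_scale[OF this, of v 1] show ?thesis by simp
qed

lemma zeta_nonzero:
  assumes "d \<in> L" "\<tau> \<in> dom d"
  shows "\<zeta> d \<tau> 1 \<noteq> 0"
proof -
  obtain v where "\<zeta> d \<tau> v \<noteq> 0"
    using zeta assms unfolding nowhere_zero_one_form_def by blast
  then show ?thesis using zeta_scale[OF assms, of v] by auto
qed

context
  fixes H :: "'l \<Rightarrow> real^5"
  assumes H: "smooth_map L (topspace X) H"
begin

text \<open>One chart determines the value because \<zeta> does not vanish there; the other charts
  agree because \<open>dH\<close> and \<zeta> transform by the same factor.\<close>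

lemma deriv_wrt_eq:
  assumes "d \<in> L" "\<tau> \<in> dom d"
  shows "deriv_wrt L \<zeta> H \<tau> = inverse (\<zeta> d \<tau> 1) *\<^sub>R diff_in d H \<tau> 1"
proof -
  have scale: "diff_in e H \<tau> v = v *\<^sub>R diff_in e H \<tau> 1" if "e \<in> L" "\<tau> \<in> dom e" for e v
  proof -
    have "\<tau> \<in> topspace X" using that dom_subset by blast
    from linear_scale[OF linear_diff_in[OF that(1) H this that(2)], of v 1] show ?thesis by simp
  qed
  show ?thesis
    unfolding deriv_wrt_def
  proof (rule the_equality, intro ballI impI allI)
    fix e v assume e: "e \<in> L" "\<tau> \<in> dom e"
    then have "\<tau> \<in> topspace X" using dom_subset by blast
    from diff_in_chart_change[OF e(1) assms(1) openin_topspace this e(2) assms(2) H]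
    have "diff_in e H \<tau> v = diff_in e (coord d) \<tau> v *\<^sub>R diff_in d H \<tau> 1"
      using scale[OF assms] by metis
    moreover have "\<zeta> e \<tau> v = \<zeta> d \<tau> (diff_in e (coord d) \<tau> v)"
      using zeta e assms unfolding nowhere_zero_one_form_def one_form_def by blast
    ultimately show "diff_in e H \<tau> v = \<zeta> e \<tau> v *\<^sub>R inverse (\<zeta> d \<tau> 1) *\<^sub>R diff_in d H \<tau> 1"
      using zeta_nonzero[OF assms] zeta_scale[OF assms, of "diff_in e (coord d) \<tau> v"] by simp
  next
    fix D assume "\<forall>e\<in>L. \<tau> \<in> dom e \<longrightarrow> (\<forall>v. diff_in e H \<tau> v = \<zeta> e \<tau> v *\<^sub>R D)"
    then have "diff_in d H \<tau> 1 = \<zeta> d \<tau> 1 *\<^sub>R D" using assms by blast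
    then show "D = inverse (\<zeta> d \<tau> 1) *\<^sub>R diff_in d H \<tau> 1"
      using zeta_nonzero[OF assms] by simp
  qed
qed

lemma diff_in_deriv_wrt:
  assumes "d \<in> L" "\<tau> \<in> dom d"
  shows "diff_in d H \<tau> 1 = \<zeta> d \<tau> 1 *\<^sub>R deriv_wrt L \<zeta> H \<tau>"
  using deriv_wrt_eq[OF assms] zeta_nonzero[OF assms] by simp

text \<open>In a chart this is the ordinary derivative divided by the nonvanishing coefficient of
  \<zeta>. Smoothness of the result is what permits iterated derivatives.\<close>

lemma smooth_map_deriv_wrt: "smooth_map L (topspace X) (deriv_wrt L \<zeta> H)"
proof (rule smooth_mapI[OF _ openin_topspace])
  fix d k assume d: "d \<in> L" and o: "open (coord d ` (topspace X \<inter> dom d))"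
  let ?S = "coord d ` (topspace X \<inter> dom d)"
  have sub: "param d p \<in> dom d" "coord d (param d p) = p" if "p \<in> ?S" for p
    using that param_in[OF d that] coord_param[OF d] by auto
  have "smooth_on (\<lambda>p. frechet_derivative (H \<circ> param d) (at p) 1) ?S"
    using H d by (intro smooth_on_frechet_derivative) (simp add: smooth_map_def)
  moreover have "smooth_on (\<lambda>p. \<zeta> d (param d p) 1) (coord d ` dom d)"
    using zeta d unfolding nowhere_zero_one_form_def one_form_def by blast
  then have "Ck_on k (\<lambda>p. \<zeta> d (param d p) 1) ?S"
    by (auto simp: smooth_on_def intro: Ck_on_subset)
  then have "Ck_on k (\<lambda>p. inverse (\<zeta> d (param d p) 1)) ?S"
    by (intro Ck_on_inverse o) (use zeta_nonzero[OF d] sub in auto)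
  ultimately have "Ck_on k (\<lambda>p. inverse (\<zeta> d (param d p) 1) *\<^sub>R frechet_derivative (H \<circ> param d) (at p) 1) ?S"
    by (intro Ck_on_bilinear[OF o bounded_bilinear_scaleR]) (auto simp: smooth_on_def)
  then show "Ck_on k (\<lambda>p. deriv_wrt L \<zeta> H (param d p)) ?S"
    by (rule Ck_on_cong[OF o, rotated]) (use sub deriv_wrt_eq[OF d] in \<open>auto simp: diff_in_def\<close>)
qed

end

end

section \<open>Pulling curves and forms back from the leaf space to the surface\<close>

locale leaf_surface = manifold X A for X :: "'a topology" and A :: "('a, real^2) chart set" +
  fixes N :: "'a \<Rightarrow> real^5" and L :: "('a set, real) chart set"
    and \<zeta> :: "('a set, real) chart \<Rightarrow> 'a set \<Rightarrow> real \<Rightarrow> real"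
  assumes leaves: "leaf_manifold X A N L" and form: "nowhere_zero_one_form L \<zeta>"
begin

sublocale leaves: curve_manifold "leaf_space X A N" L \<zeta>
  using leaves form by unfold_locales (auto simp: leaf_manifold_def)

definition over :: "('a set, real) chart \<Rightarrow> 'a set" where
  "over d = {x \<in> topspace X. leaf X A N x \<in> dom d}"

lemma openin_over: "d \<in> L \<Longrightarrow> openin X (over d)"
  using leaves.openin_dom[of d] by (simp add: openin_leaf_space over_def)

lemma smooth_coord_leaf: "d \<in> L \<Longrightarrow> smooth_map A (over d) (\<lambda>x. coord d (leaf X A N x))"
  using leaves by (auto simp: leaf_manifold_def Let_def over_def o_def)

lemma leaf_topspace: "x \<in> topspace X \<Longrightarrow> leaf X A N x \<in> topspace (leaf_space X A N)"
  by (simp add: topspace_leaf_space)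

lemma obtain_leaf_chart:
  assumes "x \<in> topspace X"
  obtains d where "d \<in> L" "x \<in> over d"
  using leaves.obtain_chart[OF leaf_topspace[OF assms]] assms by (metis (mono_tags, lifting) mem_Collect_eq over_def)

context
  fixes H :: "'a set \<Rightarrow> real^5"
  assumes H: "smooth_map L (topspace (leaf_space X A N)) H"
begin

lemma smooth_on_leaf_chart: "d \<in> L \<Longrightarrow> smooth_on (\<lambda>s. H (param d s)) (coord d ` dom d)"
  using H leaves.dom_subset[of d] unfolding smooth_map_def o_def by (metis inf.absorb_iff2)

lemma leaf_param: "d \<in> L \<Longrightarrow> x \<in> over d \<Longrightarrow> H (param d (coord d (leaf X A N x))) = H (leaf X A N x)"
  using leaves.param_coord[of d] by (simp add: over_def)

lemma smooth_map_leaf_chart: "d \<in> L \<Longrightarrow> smooth_map A (over d) (\<lambda>x. H (param d (coord d (leaf X A N x))))"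
  by (rule smooth_map_compose[OF openin_over smooth_coord_leaf _ smooth_on_leaf_chart]) (auto simp: over_def)

text \<open>Near each point the map factors through the real coordinate of a leaf chart, so
  composition with a smooth function of one variable suffices.\<close>

lemma smooth_map_leaf: "smooth_map A (topspace X) (\<lambda>x. H (leaf X A N x))"
proof (rule smooth_map_local[OF openin_topspace])
  fix x assume "x \<in> topspace X"
  then obtain d where d: "d \<in> L" "x \<in> over d" by (rule obtain_leaf_chart)
  have "smooth_map A (over d) (\<lambda>x. H (leaf X A N x))"
    by (rule smooth_map_cong[OF openin_over smooth_map_leaf_chart leaf_param, OF d(1) d(1) d(1)])
  with d openin_over[OF d(1)] show "\<exists>W. x \<in> W \<and> openin X W \<and> smooth_map A W (\<lambda>x. H (leaf X A N x))"
    by (intro exI[of _ "over d"] conjI)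
qed

lemma diff_in_leaf:
  assumes "c \<in> A" "x \<in> dom c" "d \<in> L" "x \<in> over d"
  shows "diff_in c (\<lambda>y. H (leaf X A N y)) x v =
    \<zeta> d (leaf X A N x) (diff_in c (\<lambda>y. coord d (leaf X A N y)) x v) *\<^sub>R deriv_wrt L \<zeta> H (leaf X A N x)"
proof -
  let ?t = "\<lambda>y. coord d (leaf X A N y)"
  have l: "leaf X A N x \<in> dom d" using assms(4) by (simp add: over_def)
  have "diff_in c (\<lambda>y. H (leaf X A N y)) x v = diff_in c (\<lambda>y. H (param d (?t y))) x v"
    by (rule diff_in_cong[OF assms(1) openin_over[OF assms(3)] assms(4,2)
          smooth_map_leaf_chart[OF assms(3)] leaf_param[OF assms(3)]])
  also have "\<dots> = diff_in c ?t x v *\<^sub>R frechet_derivative (\<lambda>s. H (param d s)) (at (?t x)) 1"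
    by (rule diff_in_compose[OF assms(1,4,2) smooth_coord_leaf[OF assms(3)] _ smooth_on_leaf_chart[OF assms(3)]])
      (use l in auto)
  also have "frechet_derivative (\<lambda>s. H (param d s)) (at (?t x)) 1 = diff_in d H (leaf X A N x) 1"
    by (simp add: diff_in_def o_def)
  also have "\<dots> = \<zeta> d (leaf X A N x) 1 *\<^sub>R deriv_wrt L \<zeta> H (leaf X A N x)"
    by (rule leaves.diff_in_deriv_wrt[OF H assms(3) l])
  finally show ?thesis
    using leaves.zeta_scale[OF assms(3) l, of "diff_in c ?t x v"] by simp
qed

end

text \<open>\<theta> is the pullback of \<zeta> at \<open>x\<close>. It is nonzero because the
  projection is a submersion, and the same \<theta> works for all \<open>H\<close>, so successive
  derivatives can share it.\<close>

lemma pullback_form: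
  assumes "c \<in> A" "x \<in> dom c"
  obtains \<theta> v where "\<theta> v \<noteq> 0"
    "\<And>H v. smooth_map L (topspace (leaf_space X A N)) H \<Longrightarrow>
      diff_in c (\<lambda>y. H (leaf X A N y)) x v = \<theta> v *\<^sub>R deriv_wrt L \<zeta> H (leaf X A N x)"
proof -
  have "x \<in> topspace X" using dom_subset assms by blast
  then obtain d where d: "d \<in> L" "x \<in> over d" by (rule obtain_leaf_chart)
  have "\<exists>v. diff_in c (coord d \<circ> leaf X A N) x v \<noteq> 0"
    using leaves d assms unfolding leaf_manifold_def Let_def over_def by blast
  then obtain v where v: "diff_in c (\<lambda>y. coord d (leaf X A N y)) x v \<noteq> 0"
    by (auto simp: o_def)
  have l: "leaf X A N x \<in> dom d" using d(2) by (simp add: over_def)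
  show ?thesis
  proof (rule that)
    show "\<zeta> d (leaf X A N x) (diff_in c (\<lambda>y. coord d (leaf X A N y)) x v) \<noteq> 0"
      using v leaves.zeta_nonzero[OF d(1) l]
      by (subst leaves.zeta_scale[OF d(1) l]) simp
  qed (rule diff_in_leaf[OF _ assms d])
qed

end

section \<open>Second order frames\<close>

lemma bounded_linear_column: "bounded_linear (column k :: real^'n^'m \<Rightarrow> real^'m)"
  by (intro linear_conv_bounded_linear[THEN iffD1] linearI) (auto simp: column_def vec_eq_iff)

locale surface = manifold X A for X :: "'a topology" and A :: "('a, real^2) chart set" +
  fixes f :: "'a \<Rightarrow> (real^5) set"
begin

context
  fixes U :: "'a set" and F :: "'a \<Rightarrow> real^5^5"
  assumes frame: "conformal_frame X A f U F"
begin

lemma frame_open: "openin X U" and frame_smooth: "smooth_map A U F"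
  and frame_isometry: "x \<in> U \<Longrightarrow> F x \<in> isometries"
  and frame_ray: "x \<in> U \<Longrightarrow> f x = ray (column 0 (F x))"
  using frame G23_isometries by (auto simp: conformal_frame_def)

lemma smooth_column: "smooth_map A U (\<lambda>y. column k (F y))"
  by (rule smooth_map_linear[OF frame_open bounded_linear_column frame_smooth])

context
  fixes c x assumes c: "c \<in> A" and x: "x \<in> U" "x \<in> dom c"
begin

text \<open>The connection forms are the frame coefficients of \<open>dF_k\<close>. From here on
  they are handled as inner products, with the signs of the dual basis.\<close>

lemma phi_frame:
  "phi c F 0 k x v = - ip (column 4 (F x)) (diff_in c (\<lambda>y. column k (F y)) x v)"
  "phi c F 1 k x v = - ip (column 1 (F x)) (diff_in c (\<lambda>y. column k (F y)) x v)"
  "phi c F 2 k x v = ip (column 2 (F x)) (diff_in c (\<lambda>y. column k (F y)) x v)"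
  "phi c F 3 k x v = ip (column 3 (F x)) (diff_in c (\<lambda>y. column k (F y)) x v)"
proof -
  have "phi c F j k x v = (matrix_inv (F x) *v diff_in c (\<lambda>y. column k (F y)) x v) $ j" for j
    unfolding diff_in_linear[OF c x bounded_linear_column frame_smooth]
    by (simp add: phi_def matrix_matrix_mult_def matrix_vector_mult_def column_def)
  then show
    "phi c F 0 k x v = - ip (column 4 (F x)) (diff_in c (\<lambda>y. column k (F y)) x v)"
    "phi c F 1 k x v = - ip (column 1 (F x)) (diff_in c (\<lambda>y. column k (F y)) x v)"
    "phi c F 2 k x v = ip (column 2 (F x)) (diff_in c (\<lambda>y. column k (F y)) x v)"
    "phi c F 3 k x v = ip (column 3 (F x)) (diff_in c (\<lambda>y. column k (F y)) x v)"
    by (simp_all add: frame_coefficients[OF frame_isometry[OF x(1)]])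
qed

lemma frame_skew:
  "ip (column i (F x)) (diff_in c (\<lambda>y. column j (F y)) x v)
    = - ip (column j (F x)) (diff_in c (\<lambda>y. column i (F y)) x v)"
proof -
  have "ip (column i (F y)) (column j (F y)) = ip (axis i 1) (axis j 1)" if "y \<in> U" for y
    unfolding column_conv by (rule isometry_ip[OF frame_isometry[OF that]])
  from diff_in_ip_const[OF c frame_open x smooth_column smooth_column this]
  show ?thesis
    by (simp add: ip_commute[of "diff_in _ _ _ _"] eq_neg_iff_add_eq_0 add.commute)
qed

lemma frame_skew_diag: "ip (column i (F x)) (diff_in c (\<lambda>y. column i (F y)) x v) = 0"
  using frame_skew[of i i v] by simp

text \<open>Trades a derivative of \<open>H\<close> for one of a frame vector, provided their inner
  product is constant on all of \<open>U\<close>, not merely at \<open>x\<close>.\<close>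

lemma diff_perp:
  assumes "smooth_map A U H" "\<And>y. y \<in> U \<Longrightarrow> ip (column j (F y)) (H y) = a"
  shows "ip (column j (F x)) (diff_in c H x v) = - ip (H x) (diff_in c (\<lambda>y. column j (F y)) x v)"
proof -
  from diff_in_ip_const[OF c frame_open x smooth_column assms(1,2)]
  have "ip (diff_in c (\<lambda>y. column j (F y)) x v) (H x) + ip (column j (F x)) (diff_in c H x v) = 0" .
  then show ?thesis
    by (simp add: ip_commute[of "diff_in c (\<lambda>y. column j (F y)) x v"])
qed

end

end

lemma second_order_conformal: "second_order_frame X A f U F \<Longrightarrow> conformal_frame X A f U F"
  by (simp add: second_order_frame_def)

text \<open>The sign of \<open>phi_frame\<close> for index 1 turns the positive wedge into a
  negative one; skew symmetry replaces derivatives of columns 1 and 2 by those of column 3.\<close>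

lemma second_order_ip:
  assumes F: "second_order_frame X A f U F" and c: "c \<in> A" and x: "x \<in> U" "x \<in> dom c"
  defines "D \<equiv> \<lambda>k. diff_in c (\<lambda>y. column k (F y)) x"
  shows "ip (column 3 (F x)) (D 0 v) = 0"
    and "wedge (\<lambda>v. ip (column 1 (F x)) (D 0 v)) (\<lambda>v. ip (column 2 (F x)) (D 0 v)) (axis 1 1) (axis 2 1) < 0"
    and "wedge (\<lambda>v. ip (column 1 (F x)) (D 3 v)) (\<lambda>v. ip (column 2 (F x)) (D 0 v)) u v
      = wedge (\<lambda>v. ip (column 2 (F x)) (D 3 v)) (\<lambda>v. ip (column 1 (F x)) (D 0 v)) u v"
proof -
  note so = F[unfolded second_order_frame_def, THEN conjunct2, rule_format, OF c, of x]
  note ph = phi_frame[OF second_order_conformal[OF F] c x]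
  note sk = frame_skew[OF second_order_conformal[OF F] c x, of 3]
  show "ip (column 3 (F x)) (D 0 v) = 0"
    using so x ph(4)[of 0 v] by (simp add: D_def)
  show "wedge (\<lambda>v. ip (column 1 (F x)) (D 0 v)) (\<lambda>v. ip (column 2 (F x)) (D 0 v)) (axis 1 1) (axis 2 1) < 0"
    using so x by (simp add: wedge_def D_def ph)
  have "wedge (phi c F 3 1 x) (phi c F 2 0 x) u v + wedge (phi c F 3 2 x) (phi c F 1 0 x) u v = 0"
    using so x by blast
  then show "wedge (\<lambda>v. ip (column 1 (F x)) (D 3 v)) (\<lambda>v. ip (column 2 (F x)) (D 0 v)) u v
      = wedge (\<lambda>v. ip (column 2 (F x)) (D 3 v)) (\<lambda>v. ip (column 1 (F x)) (D 0 v)) u v"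
    by (simp add: wedge_def D_def ph sk)
qed

text \<open>\<open>Q\<^sub>i\<close>, \<open>R\<^sub>i\<close> and \<open>P\<^sub>i\<close> are the pairings of \<open>F\<^sub>i\<close> with \<open>dF\<^sub>0\<close>, \<open>dF\<^sub>3\<close> and
  \<open>dM\<close> on two tangent vectors \<open>a\<close>, \<open>b\<close>, where \<open>M = x F\<^sub>0 + y F\<^sub>3\<close> is the third vector of another second
  order frame \<open>G\<close>; \<open>(r, s)\<close> and \<open>(r', s')\<close> are the pairings of \<open>F\<^sub>1, F\<^sub>2\<close> with \<open>G\<^sub>1\<close> and \<open>G\<^sub>2\<close>.\<close>

lemma trace_free_algebra:
  fixes x y \<rho> :: real
  assumes P: "P1a = x * Q1a + y * R1a" "P1b = x * Q1b + y * R1b" "P2a = x * Q2a + y * R2a" "P2b = x * Q2b + y * R2b"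
    and R: "R1a * Q2b - R1b * Q2a = R2a * Q1b - R2b * Q1a"
    and Q: "Q1a * Q2b - Q1b * Q2a < 0"
    and Q': "(\<rho> * (s * Q2a - r * Q1a)) * (\<rho> * (s' * Q2b - r' * Q1b)) - (\<rho> * (s * Q2b - r * Q1b)) * (\<rho> * (s' * Q2a - r' * Q1a)) < 0"
    and P': "(s * P2a - r * P1a) * (\<rho> * (s' * Q2b - r' * Q1b)) - (s * P2b - r * P1b) * (\<rho> * (s' * Q2a - r' * Q1a))
      = (s' * P2a - r' * P1a) * (\<rho> * (s * Q2b - r * Q1b)) - (s' * P2b - r' * P1b) * (\<rho> * (s * Q2a - r * Q1a))"
  shows "x = 0"
proof -
  \<comment> \<open>The condition on the second frame is a trace of \<open>P\<close> relative to
    \<open>Q\<close>, multiplied by the determinant of the change of the first two spacelike and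
    timelike vectors.\<close>
  have "\<rho> * (r * s' - r' * s) * (P1a * Q2b - P1b * Q2a - (P2a * Q1b - P2b * Q1a)) = 0"
    using P' by (simp add: algebra_simps)
  moreover have "\<rho> * \<rho> * (r * s' - r' * s) * (Q1a * Q2b - Q1b * Q2a) \<noteq> 0"
    using Q' by (simp add: algebra_simps)
  \<comment> \<open>\<open>R\<close> has zero trace by the second order condition on the first
    frame, so only the \<open>Q\<close> part of \<open>P\<close> contributes.\<close>
  moreover have "P1a * Q2b - P1b * Q2a - (P2a * Q1b - P2b * Q1a) = 2 * x * (Q1a * Q2b - Q1b * Q2a)"
  proof -
    have "P1a * Q2b - P1b * Q2a - (P2a * Q1b - P2b * Q1a) =
      2 * x * (Q1a * Q2b - Q1b * Q2a) + y * (R1a * Q2b - R1b * Q2a - (R2a * Q1b - R2b * Q1a))"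
      unfolding P by (simp add: algebra_simps)
    then show ?thesis using R by simp
  qed
  ultimately show ?thesis by auto
qed

section \<open>Independence of the conformal Gauss map from the second order frame\<close>

lemma ray_eqD: "ray V = ray W \<Longrightarrow> \<exists>\<rho>>0. V = \<rho> *\<^sub>R W"
proof -
  assume "ray V = ray W"
  moreover have "V \<in> ray V" unfolding ray_def by (auto intro: exI[of _ 1])
  ultimately show ?thesis unfolding ray_def by auto
qed

lemma wedge_nonzero_kernel:
  fixes \<alpha> \<beta> :: "real^2 \<Rightarrow> real"
  assumes "wedge \<alpha> \<beta> u v \<noteq> 0" "\<And>v. p * \<alpha> v + q * \<beta> v = 0"
  shows "p = 0" "q = 0"
proof -
  have "p * wedge \<alpha> \<beta> u v = (p * \<alpha> u + q * \<beta> u) * \<beta> v - (p * \<alpha> v + q * \<beta> v) * \<beta> u"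
    and "q * wedge \<alpha> \<beta> u v = (p * \<alpha> v + q * \<beta> v) * \<alpha> u - (p * \<alpha> u + q * \<beta> u) * \<alpha> v"
    by (simp_all add: wedge_def algebra_simps)
  then have "p * wedge \<alpha> \<beta> u v = 0" "q * wedge \<alpha> \<beta> u v = 0"
    unfolding assms(2) by simp_all
  with assms(1) show "p = 0" "q = 0" by auto
qed

text \<open>Column 3 of \<open>G\<close> is orthogonal to column 0 of \<open>F\<close> and its
  derivatives, so it lies in the span of columns 0 and 3 of \<open>F\<close>. The trace condition
  removes column 0. The unspecified factor \<sigma> is harmless, as only orthogonality to the frame
  is used later.\<close>

lemma gauss_map_unique:
  assumes F: "second_order_frame X A f U F" and G: "second_order_frame X A f W G"
    and x: "x \<in> U" "x \<in> W"
  shows "\<exists>\<sigma>. \<sigma> \<noteq> 0 \<and> column 3 (G x) = \<sigma> *\<^sub>R column 3 (F x)"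
proof -
  let ?V = "U \<inter> W"
  note cF = second_order_conformal[OF F] and cG = second_order_conformal[OF G]
  have V: "openin X ?V" using frame_open[OF cF] frame_open[OF cG] by auto
  note sF = smooth_map_subset[OF smooth_column[OF cF], of ?V, OF Int_lower1]
    and sG = smooth_map_subset[OF smooth_column[OF cG], of ?V, OF Int_lower2]
  define M where "M y = column 3 (G y)" for y
  \<comment> \<open>Column 4 pairs with column 0 to -1, so this is the factor between the two lifts
    of \<open>f\<close>, given by a visibly smooth formula.\<close>
  define \<rho> where "\<rho> y = - ip (column 4 (F y)) (column 0 (G y))" for y
  have sM: "smooth_map A ?V M" unfolding M_def by (rule sG)
  have s\<rho>: "smooth_map A ?V \<rho>"
    using smooth_map_diff[OF V smooth_map_const[OF V, of 0] smooth_map_ip[OF V sF sG]]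
    unfolding \<rho>_def by simp
  have G0: "column 0 (G y) = \<rho> y *\<^sub>R column 0 (F y)" "\<rho> y > 0" if y: "y \<in> ?V" for y
  proof -
    from y have "ray (column 0 (G y)) = ray (column 0 (F y))"
      using frame_ray[OF cF] frame_ray[OF cG] by auto
    then obtain r where r: "r > 0" "column 0 (G y) = r *\<^sub>R column 0 (F y)"
      using ray_eqD by blast
    then have "\<rho> y = r" using frame_ip[OF frame_isometry[OF cF]] y by (simp add: \<rho>_def)
    with r show "column 0 (G y) = \<rho> y *\<^sub>R column 0 (F y)" "\<rho> y > 0" by auto
  qed
  have D0: "diff_in c (\<lambda>y. column 0 (G y)) y v = \<rho> y *\<^sub>R diff_in c (\<lambda>y. column 0 (F y)) y v
      + diff_in c \<rho> y v *\<^sub>R column 0 (F y)" if "y \<in> ?V" "c \<in> A" "y \<in> dom c" for y c v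
    using diff_in_bilinear[OF that(2,1,3) bounded_bilinear_scaleR s\<rho> sF]
      diff_in_cong[OF that(2) V that(1,3) smooth_map_bilinear[OF V bounded_bilinear_scaleR s\<rho> sF], of _ "\<lambda>y. column 0 (G y)"]
      G0(1) by simp
  have perp: "ip (column j (F y)) (M y) = 0" if y: "y \<in> ?V" and j: "j \<in> {0, 1, 2}" for y j
  proof -
    have "y \<in> topspace X" using y frame_open[OF cF] openin_subset by auto
    then obtain c where c: "c \<in> A" "y \<in> dom c" by (rule obtain_chart)
    have y': "y \<in> U" "y \<in> W" using y by auto
    note gF = frame_ip[OF frame_isometry[OF cF y'(1)]] and gG = frame_ip[OF frame_isometry[OF cG y'(2)]]
    let ?D = "diff_in c (\<lambda>y. column 0 (F y)) y"
    have "ip (\<rho> y *\<^sub>R column 0 (F y)) (M y) = 0"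
      unfolding G0(1)[OF y, symmetric] M_def using gG by blast
    then have 0: "ip (column 0 (F y)) (M y) = 0"
      using G0(2)[OF y] by simp
    have "ip (M y) (?D v) = 0" for v
      using second_order_ip(1)[OF G c(1) y'(2) c(2), of v] D0[OF y c, of v] G0(2)[OF y] 0
      by (simp add: M_def ip_commute[of "column 3 (G y)" "column 0 (F y)"])
    moreover have "ip (M y) (?D v) = - ip (column 1 (F y)) (M y) * ip (column 1 (F y)) (?D v)
        + ip (column 2 (F y)) (M y) * ip (column 2 (F y)) (?D v)" for v
      using ip_expand[OF frame_isometry[OF cF y'(1)], of "M y" "?D v"] 0
        second_order_ip(1)[OF F c(1) y'(1) c(2)] frame_skew_diag[OF cF c(1) y'(1) c(2), of 0] by simp
    ultimately have *: "- ip (column 1 (F y)) (M y) * ip (column 1 (F y)) (?D v)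
        + ip (column 2 (F y)) (M y) * ip (column 2 (F y)) (?D v) = 0" for v
      by simp
    \<comment> \<open>The immersion condition makes these two forms independent, so both
      coefficients in \<open>*\<close> vanish.\<close>
    have "wedge (\<lambda>v. ip (column 1 (F y)) (?D v)) (\<lambda>v. ip (column 2 (F y)) (?D v)) (axis 1 1) (axis 2 1) \<noteq> 0"
      using second_order_ip(2)[OF F c(1) y'(1) c(2)] by simp
    from wedge_nonzero_kernel[OF this *] 0 j show ?thesis by auto
  qed
  define a where "a y = - ip (column 4 (F y)) (M y)" for y
  define b where "b y = ip (column 3 (F y)) (M y)" for y
  have sa: "smooth_map A ?V a"
    using smooth_map_diff[OF V smooth_map_const[OF V, of 0] smooth_map_ip[OF V sF sM]]
    unfolding a_def by simp
  have sb: "smooth_map A ?V b"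
    unfolding b_def by (rule smooth_map_ip[OF V sF sM])
  have M: "M y = a y *\<^sub>R column 0 (F y) + b y *\<^sub>R column 3 (F y)" if y: "y \<in> ?V" for y
  proof -
    have y': "y \<in> U" using y by auto
    have "\<forall>j. ip (column j (F y)) (M y) = ip (column j (F y)) (a y *\<^sub>R column 0 (F y) + b y *\<^sub>R column 3 (F y))"
      unfolding all_5 using perp[OF y] by (simp add: frame_ip[OF frame_isometry[OF cF y']] a_def b_def)
    then show ?thesis
      by (intro frame_eqI[OF frame_isometry[OF cF y']]) blast
  qed
  have xV: "x \<in> ?V" using x by simp
  have "x \<in> topspace X" using x frame_open[OF cF] openin_subset by auto
  then obtain c where c: "c \<in> A" "x \<in> dom c" by (rule obtain_chart)
  define D where "D k = diff_in c (\<lambda>y. column k (F y)) x" for k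
  define E where "E k = diff_in c (\<lambda>y. column k (G y)) x" for k
  note gF = frame_ip[OF frame_isometry[OF cF x(1)]] and gG = frame_ip[OF frame_isometry[OF cG x(2)]]
  note expand = ip_expand[OF frame_isometry[OF cF x(1)]]
  \<comment> \<open>The terms along columns 0 and 3 of \<open>F\<close> disappear after pairing with
    columns 1 and 2 of either frame, leaving the combination \<open>P = a Q + b R\<close> of
    \<open>trace_free_algebra\<close>.\<close>
  have E3: "E 3 v = a x *\<^sub>R D 0 v + diff_in c a x v *\<^sub>R column 0 (F x) + (b x *\<^sub>R D 3 v + diff_in c b x v *\<^sub>R column 3 (F x))" for v
  proof -
    note sm = smooth_map_bilinear[OF V bounded_bilinear_scaleR]
    have "E 3 v = diff_in c (\<lambda>y. a y *\<^sub>R column 0 (F y) + b y *\<^sub>R column 3 (F y)) x v"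
      unfolding E_def
      by (rule diff_in_cong[OF c(1) V xV c(2) smooth_map_add[OF V sm[OF sa sF] sm[OF sb sF]]])
        (use M in \<open>simp add: M_def\<close>)
    also have "\<dots> = diff_in c (\<lambda>y. a y *\<^sub>R column 0 (F y)) x v + diff_in c (\<lambda>y. b y *\<^sub>R column 3 (F y)) x v"
      by (rule diff_in_eqI) (rule has_derivative_add; rule has_derivative_diff_in[OF c(1) _ xV c(2)]; rule sm[OF _ sF]; fact)
    finally show ?thesis
      by (simp add: diff_in_bilinear[OF c(1) xV c(2) bounded_bilinear_scaleR _ sF] sa sb D_def)
  qed
  have E0: "E 0 v = \<rho> x *\<^sub>R D 0 v + diff_in c \<rho> x v *\<^sub>R column 0 (F x)" for v
    using D0[OF xV c] by (simp add: E_def D_def)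
  have D00: "ip (column 0 (F x)) (D 0 v) = 0" "ip (column 3 (F x)) (D 0 v) = 0" for v
    using frame_skew_diag[OF cF c(1) x(1) c(2), of 0] second_order_ip(1)[OF F c(1) x(1) c(2)]
    by (simp_all add: D_def)
  have D03: "ip (column 0 (F x)) (D 3 v) = 0" for v
    using frame_skew[OF cF c(1) x(1) c(2), of 0 3] D00 by (simp add: D_def)
  have Gperp: "ip (column 0 (F x)) (column j (G x)) = 0" "ip (column 3 (F x)) (column j (G x)) = 0" if "j \<in> {1, 2}" for j
  proof -
    have "ip (\<rho> x *\<^sub>R column 0 (F x)) (column j (G x)) = 0"
      using gG that unfolding G0(1)[OF xV, symmetric] by auto
    then show 0: "ip (column 0 (F x)) (column j (G x)) = 0" using G0(2)[OF xV] by simp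
    have "ip (a x *\<^sub>R column 0 (F x) + b x *\<^sub>R column 3 (F x)) (column j (G x)) = 0"
      using gG that unfolding M[OF xV, symmetric] M_def by auto
    moreover have "b x \<noteq> 0"
    proof
      assume "b x = 0"
      then have "ip (M x) (M x) = 0" using M[OF xV] gF by simp
      then show False using gG by (simp add: M_def)
    qed
    ultimately show "ip (column 3 (F x)) (column j (G x)) = 0" using 0 by simp
  qed
  have GE0: "ip (column j (G x)) (E 0 v) = \<rho> x * (ip (column 2 (F x)) (column j (G x)) * ip (column 2 (F x)) (D 0 v)
      - ip (column 1 (F x)) (column j (G x)) * ip (column 1 (F x)) (D 0 v))" if "j \<in> {1, 2}" for j v
    unfolding E0 expand[of "column j (G x)"] using Gperp[OF that] D00 gF by (simp add: algebra_simps)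
  have GE3: "ip (column j (G x)) (E 3 v) = ip (column 2 (F x)) (column j (G x)) * ip (column 2 (F x)) (E 3 v)
      - ip (column 1 (F x)) (column j (G x)) * ip (column 1 (F x)) (E 3 v)" if "j \<in> {1, 2}" for j v
    using expand[of "column j (G x)" "E 3 v"] Gperp[OF that] D00 D03 gF by (simp add: E3)
  have P: "ip (column j (F x)) (E 3 v) = a x * ip (column j (F x)) (D 0 v) + b x * ip (column j (F x)) (D 3 v)"
    if "j \<in> {1, 2}" for j v
    unfolding E3 using gF that by auto
  note so = second_order_ip[OF F c(1) x(1) c(2), folded D_def] second_order_ip[OF G c(1) x(2) c(2), folded E_def]
  have "a x = 0"
    by (rule trace_free_algebra[OF P[of 1 "axis 1 1"] P[of 1 "axis 2 1"] P[of 2 "axis 1 1"] P[of 2 "axis 2 1"],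
        OF _ _ _ _ so(3)[of "axis 1 1" "axis 2 1", unfolded wedge_def] so(2)[unfolded wedge_def]
          so(5)[unfolded wedge_def GE0[of 1, simplified] GE0[of 2, simplified]]
          so(6)[of "axis 1 1" "axis 2 1", unfolded wedge_def GE0[of 1, simplified] GE0[of 2, simplified]
            GE3[of 1, simplified] GE3[of 2, simplified]]]) auto
  moreover have "b x \<noteq> 0"
  proof
    assume "b x = 0"
    then have "ip (M x) (M x) = 0" using M[OF xV] gF by simp
    then show False using gG by (simp add: M_def)
  qed
  ultimately show ?thesis
    using M[OF xV] by (auto simp: M_def)
qed

end

section \<open>Frames along a surface with one-dimensional Gauss image\<close>

lemma bivector_zero_imp_parallel:
  assumes "bivector V W = 0" "V \<noteq> 0"
  shows "\<exists>t. W = t *\<^sub>R V"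
proof -
  obtain i where i: "V $ i \<noteq> 0" using assms(2) by (auto simp: vec_eq_iff)
  have "V $ i * W $ j = V $ j * W $ i" for j
    using assms(1) by (simp add: bivector_def vec_eq_iff)
  then have "W = (W $ i / V $ i) *\<^sub>R V"
    using i by (simp add: vec_eq_iff field_simps)
  then show ?thesis by blast
qed

lemma (in manifold) smooth_map_gauge:
  fixes F :: "'a \<Rightarrow> real^5^5"
  assumes "openin X U" "smooth_map A U F" "smooth_map A U r" "smooth_map A U s" "smooth_map A U a" "smooth_map A U b"
    and "\<And>y. y \<in> U \<Longrightarrow> r y \<noteq> 0" "\<And>y. y \<in> U \<Longrightarrow> s y \<noteq> 0"
  shows "smooth_map A U (\<lambda>y. F y ** gauge (r y) (s y) (a y) (b y))"
proof -
  note const = smooth_map_const[OF assms(1)]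
  have "\<forall>i j. smooth_map A U (\<lambda>y. gauge (r y) (s y) (a y) (b y) $ i $ j)"
    unfolding all_5 gauge_def
    by (simp add: const assms(3) del: add_uminus_conv_diff)
      (intro conjI smooth_map_divide[OF assms(1)] smooth_map_add[OF assms(1)] smooth_map_diff[OF assms(1)]
        smooth_map_mult[OF assms(1)] const assms(3-6)
        smooth_map_linear[OF assms(1) bounded_linear_minus[OF bounded_linear_ident]]; simp add: assms(7,8))
  moreover have bl: "bounded_linear (\<lambda>M :: real^5^5. M $ i $ l)" for i l
    by (intro bounded_linear_compose[OF bounded_linear_vec_nth bounded_linear_vec_nth])
  have "smooth_map A U (\<lambda>y. F y $ i $ l)" for i l
    by (rule smooth_map_linear[OF assms(1) bl assms(2)])
  ultimately have "smooth_map A U (\<lambda>y. F y $ i $ l * gauge (r y) (s y) (a y) (b y) $ l $ j)" for i j l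
    by (intro smooth_map_mult[OF assms(1)]) blast+
  then show ?thesis
    unfolding matrix_matrix_mult_def sum_5
    by (intro smooth_map_vec_lambda[OF assms(1)] smooth_map_add[OF assms(1)])
qed

text \<open>From here the leaf space enters only through \<open>C1\<close>, \<open>C2\<close>,
  \<open>C3\<close>. A single \<theta> at each point encodes that \<open>N\<close> and its
  derivatives vary along one parameter; \<open>C3\<close> is needed to normalize column 4 of an
  adapted frame.\<close>

locale gauss_curve = surface X A f for X :: "'a topology" and A :: "('a, real^2) chart set" and f +
  fixes N C1 C2 C3 :: "'a \<Rightarrow> real^5"
  assumes smooth_C: "smooth_map A (topspace X) N" "smooth_map A (topspace X) C1"
      "smooth_map A (topspace X) C2" "smooth_map A (topspace X) C3"
    and diff_C: "c \<in> A \<Longrightarrow> x \<in> dom c \<Longrightarrow> \<exists>\<theta>. (\<exists>v. \<theta> v \<noteq> 0) \<and> (\<forall>v. diff_in c N x v = \<theta> v *\<^sub>R C1 x \<and>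
      diff_in c C1 x v = \<theta> v *\<^sub>R C2 x \<and> diff_in c C2 x v = \<theta> v *\<^sub>R C3 x)"
    and gauss: "conformal_gauss_map X A f N"
    and canonical: "canonically_oriented X A f"
begin

lemma smooth_sub:
  assumes "openin X U"
  shows "smooth_map A U N" "smooth_map A U C1" "smooth_map A U C2" "smooth_map A U C3"
  using smooth_C smooth_map_subset openin_subset[OF assms] by blast+

lemma obtain_form:
  assumes "c \<in> A" "x \<in> dom c"
  obtains \<theta> v where "\<theta> v \<noteq> 0" "\<And>v. diff_in c N x v = \<theta> v *\<^sub>R C1 x"
    "\<And>v. diff_in c C1 x v = \<theta> v *\<^sub>R C2 x" "\<And>v. diff_in c C2 x v = \<theta> v *\<^sub>R C3 x"
  using diff_C[OF assms] by blast

section \<open>Components of the derivatives of the Gauss map in a second order frame\<close>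

lemma gauss_frame:
  assumes "second_order_frame X A f U F" "x \<in> U"
  shows "\<exists>\<sigma>. \<sigma> \<noteq> 0 \<and> N x = \<sigma> *\<^sub>R column 3 (F x)"
proof -
  have "x \<in> topspace X"
    using assms frame_open[OF second_order_conformal] openin_subset by blast
  then obtain W G where "x \<in> W" "second_order_frame X A f W G" "N x = column 3 (G x)"
    using gauss unfolding conformal_gauss_map_def by blast
  then show ?thesis using gauss_map_unique[OF assms(1) _ assms(2)] by metis
qed

lemma gauss_unit: "x \<in> topspace X \<Longrightarrow> ip (N x) (N x) = 1"
  using gauss frame_ip(19)[OF frame_isometry[OF second_order_conformal]]
  unfolding conformal_gauss_map_def by metis

context
  fixes U F assumes F: "second_order_frame X A f U F"
begin

private lemmas cF = second_order_conformal[OF F]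
private lemmas openU = frame_open[OF cF]

text \<open>Differentiating the orthogonality of \<open>N\<close> to columns 0, 1, 2, 4 turns the
  forms \<open>\<phi>\<^sup>3\<^sub>j\<close> into components of \<open>C1\<close>. The canonical
  orientation then makes \<open>C1\<close> a nonzero multiple of column 1 minus column 2, modulo
  column 0.\<close>

lemma C1_frame:
  assumes x: "x \<in> U"
  shows "ip (column 0 (F x)) (C1 x) = 0" "ip (column 3 (F x)) (C1 x) = 0"
    and "ip (column 2 (F x)) (C1 x) = ip (column 1 (F x)) (C1 x)"
    and "(\<And>c v. c \<in> A \<Longrightarrow> x \<in> dom c \<Longrightarrow> phi c F 3 4 x v = 0) \<Longrightarrow> ip (column 4 (F x)) (C1 x) = 0"
    and "ip (column 1 (F x)) (C1 x) \<noteq> 0"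
    and "ip (column 0 (F x)) (C2 x) \<noteq> 0"
proof -
  have xt: "x \<in> topspace X" using x openU openin_subset by blast
  then obtain c where c: "c \<in> A" "x \<in> dom c" by (rule obtain_chart)
  obtain \<theta> v where \<theta>: "\<theta> v \<noteq> 0" "\<And>v. diff_in c N x v = \<theta> v *\<^sub>R C1 x"
    "\<And>v. diff_in c C1 x v = \<theta> v *\<^sub>R C2 x" using obtain_form[OF c] by metis
  obtain \<sigma> where \<sigma>: "\<sigma> \<noteq> 0" "N x = \<sigma> *\<^sub>R column 3 (F x)" using gauss_frame[OF F x] by blast
  define D where "D k = diff_in c (\<lambda>y. column k (F y)) x" for k
  obtain h where h: "h \<noteq> 0" "\<And>v. phi c F 3 1 x v = h * (phi c F 1 0 x v + phi c F 2 0 x v)"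
    "\<And>v. phi c F 3 2 x v = h * (phi c F 1 0 x v + phi c F 2 0 x v)"
    using canonical F c x unfolding canonically_oriented_def by blast
  note ph = phi_frame[OF cF c(1) x c(2), folded D_def]
  have N: "ip (column j (F y)) (N y) = 0" if "y \<in> U" "j \<in> {0, 1, 2, 4}" for y j
    using gauss_frame[OF F that(1)] frame_ip[OF frame_isometry[OF cF that(1)]] that(2) by auto
  have *: "\<theta> v * ip (column j (F x)) (C1 x) = - \<sigma> * phi c F 3 j x v" if "j \<in> {0, 1, 2, 4}" for j v
    using diff_perp[OF cF c(1) x c(2) smooth_sub(1)[OF openU] N[OF _ that], of v]
    by (simp add: \<theta>(2) \<sigma>(2) ph D_def)
  show 0: "ip (column 0 (F x)) (C1 x) = 0"
    using *[of 0 v] \<theta>(1) ph(4) second_order_ip(1)[OF F c(1) x c(2)] by (simp add: D_def)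
  have "ip (diff_in c N x v) (N x) + ip (N x) (diff_in c N x v) = 0"
    by (rule diff_in_ip_const[OF c(1) openin_topspace xt c(2) smooth_C(1) smooth_C(1) gauss_unit])
  then show 3: "ip (column 3 (F x)) (C1 x) = 0"
    using \<theta>(1) \<sigma>(1) by (simp add: \<theta>(2) \<sigma>(2) ip_commute[of "C1 x"])
  have "\<theta> v * ip (column 2 (F x)) (C1 x) = \<theta> v * ip (column 1 (F x)) (C1 x)"
    using *[of 1 v] *[of 2 v] by (simp add: h)
  then show 21: "ip (column 2 (F x)) (C1 x) = ip (column 1 (F x)) (C1 x)"
    using \<theta>(1) by simp
  show "ip (column 4 (F x)) (C1 x) = 0" if "\<And>c v. c \<in> A \<Longrightarrow> x \<in> dom c \<Longrightarrow> phi c F 3 4 x v = 0"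
    using *[of 4 v] that[OF c] \<theta>(1) by simp
  let ?\<alpha> = "\<lambda>v. phi c F 1 0 x v + phi c F 2 0 x v"
  \<comment> \<open>\<open>\<phi>\<^sup>1\<^sub>0\<close> and \<open>\<phi>\<^sup>2\<^sub>0\<close>
    are independent, so their sum is not the zero form.\<close>
  obtain w where w: "?\<alpha> w \<noteq> 0"
  proof -
    have "wedge (phi c F 1 0 x) (phi c F 2 0 x) (axis 1 1) (axis 2 1) > 0"
      using F c x unfolding second_order_frame_def by blast
    then have "\<not> (\<forall>v. ?\<alpha> v = 0)"
      using wedge_nonzero_kernel(1)[of "phi c F 1 0 x" "phi c F 2 0 x" "axis 1 1" "axis 2 1" 1 1] by auto
    then show ?thesis using that by blast
  qed
  have "\<theta> w * ip (column 1 (F x)) (C1 x) \<noteq> 0"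
    using *[of 1 w] w h(1) \<sigma>(1) by (simp add: h)
  then show 1: "ip (column 1 (F x)) (C1 x) \<noteq> 0" by auto
  show "ip (column 0 (F x)) (C2 x) \<noteq> 0"
  proof -
    \<comment> \<open>The first claim is repeated at every point of \<open>U\<close>, since it is
      about to be differentiated.\<close>
    have "ip (column 0 (F y)) (C1 y) = 0" if y: "y \<in> U" for y
    proof -
      have "y \<in> topspace X" using y openU openin_subset by blast
      then obtain c where c: "c \<in> A" "y \<in> dom c" by (rule obtain_chart)
      obtain \<theta> v where \<theta>: "\<theta> v \<noteq> 0" "\<And>v. diff_in c N y v = \<theta> v *\<^sub>R C1 y" using obtain_form[OF c] by metis
      obtain \<sigma> where \<sigma>: "\<sigma> \<noteq> 0" "N y = \<sigma> *\<^sub>R column 3 (F y)" using gauss_frame[OF F y] by blast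
      show ?thesis
        using diff_perp[OF cF c(1) y c(2) smooth_sub(1)[OF openU] N, of 0 v]
          second_order_ip(1)[OF F c(1) y c(2), of v] \<theta>(1) by (simp add: \<theta>(2) \<sigma>(2))
    qed
    from diff_perp[OF cF c(1) x c(2) smooth_sub(2)[OF openU] this, of w]
    have "\<theta> w * ip (column 0 (F x)) (C2 x) = - ip (C1 x) (D 0 w)"
      by (simp add: \<theta>(3) D_def)
    also have "\<dots> = - ip (column 1 (F x)) (C1 x) * ?\<alpha> w"
      using ip_expand[OF frame_isometry[OF cF x], of "C1 x" "D 0 w"] 0 3 21
        frame_skew_diag[OF cF c(1) x c(2), of 0 w]
      by (simp add: ph D_def algebra_simps)
    finally show ?thesis using 1 w by auto
  qed
qed

end

lemma C1_C2_perp: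
  assumes "openin X U" "\<And>y. y \<in> U \<Longrightarrow> ip (C1 y) (C1 y) = 0" "x \<in> U"
  shows "ip (C1 x) (C2 x) = 0"
proof -
  have "x \<in> topspace X" using assms openin_subset by blast
  then obtain c where c: "c \<in> A" "x \<in> dom c" by (rule obtain_chart)
  obtain \<theta> v where \<theta>: "\<theta> v \<noteq> 0" "\<And>v. diff_in c C1 x v = \<theta> v *\<^sub>R C2 x" using obtain_form[OF c] by metis
  have "ip (diff_in c C1 x v) (C1 x) + ip (C1 x) (diff_in c C1 x v) = 0"
    by (rule diff_in_ip_const[OF c(1) assms(1,3) c(2) smooth_sub(2)[OF assms(1)] smooth_sub(2)[OF assms(1)] assms(2)])
  then show ?thesis using \<theta>(1) by (simp add: \<theta>(2) ip_commute[of "C2 x"])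
qed

lemma adapted_second_order: "adapted_frame X A f U F \<Longrightarrow> second_order_frame X A f U F"
  by (simp add: adapted_frame_def)

text \<open>In an adapted frame \<open>C1\<close> is a multiple of the null vector
  \<open>F_1 - F_2\<close>. Exceptionality removes column 0 from \<open>C2\<close>, which leaves
  \<open>F_4\<close> and \<open>F_1 - F_2\<close>, spanning an isotropic plane.\<close>

lemma biisotropic_at:
  assumes F: "adapted_frame X A f U F" and x: "x \<in> U"
    and ex: "\<And>c v. c \<in> A \<Longrightarrow> x \<in> dom c \<Longrightarrow> ip (diff_in c N x v) (diff_in c (\<lambda>y. column 4 (F y)) x v) = 0"
  shows "ip (C1 x) (C1 x) = 0" "ip (C2 x) (C2 x) = 0" "bivector (C1 x) (C2 x) \<noteq> 0"
proof -
  note so = adapted_second_order[OF F]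
  note cF = second_order_conformal[OF so]
  note openU = frame_open[OF cF]
  note C = C1_frame[OF so]
  have nz: "C1 y \<noteq> 0" if "y \<in> U" for y
    using C(5)[OF that] by auto
  have C4: "ip (column 4 (F y)) (C1 y) = 0" if y: "y \<in> U" for y
    by (rule C(4)[OF y]) (use F y in \<open>auto simp: adapted_frame_def\<close>)
  have xt: "x \<in> topspace X" using x openU openin_subset by blast
  then obtain c where c: "c \<in> A" "x \<in> dom c" by (rule obtain_chart)
  obtain \<theta> v where \<theta>: "\<theta> v \<noteq> 0" "\<And>v. diff_in c N x v = \<theta> v *\<^sub>R C1 x"
    "\<And>v. diff_in c C1 x v = \<theta> v *\<^sub>R C2 x" using obtain_form[OF c] by metis
  have C11: "ip (C1 y) (C1 y) = 0" if "y \<in> U" for y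
    using ip_expand[OF frame_isometry[OF cF that], of "C1 y" "C1 y"] C[OF that] by simp
  show "ip (C1 x) (C1 x) = 0" by (rule C11[OF x])
  have "ip (column 1 (F x)) (C1 x) * ip (column 2 (F x)) (C2 x) = ip (column 1 (F x)) (C1 x) * ip (column 1 (F x)) (C2 x)"
    using C1_C2_perp[OF openU C11 x] ip_expand[OF frame_isometry[OF cF x], of "C1 x" "C2 x"] C(1-3)[OF x] C4[OF x]
    by simp
  then have 12: "ip (column 2 (F x)) (C2 x) = ip (column 1 (F x)) (C2 x)"
    using C(5)[OF x] by simp
  \<comment> \<open>Moving the derivative onto column 4 produces exactly the pairing that
    \<open>ex\<close> makes zero.\<close>
  have "\<theta> v * ip (column 4 (F x)) (C2 x) = - ip (C1 x) (diff_in c (\<lambda>y. column 4 (F y)) x v)"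
    using diff_perp[OF cF c(1) x c(2) smooth_sub(2)[OF openU] C4, of v] by (simp add: \<theta>(3))
  also have "\<dots> = 0" using ex[OF c, of v] \<theta>(1) by (simp add: \<theta>(2))
  finally have 4: "ip (column 4 (F x)) (C2 x) = 0" using \<theta>(1) by simp
  have "\<theta> v * ip (column 3 (F x)) (C2 x) = - ip (C1 x) (diff_in c (\<lambda>y. column 3 (F y)) x v)"
    using diff_perp[OF cF c(1) x c(2) smooth_sub(2)[OF openU] C(2), of v] by (simp add: \<theta>(3))
  also have "\<dots> = 0"
  proof -
    have "phi c F 3 1 x v = phi c F 3 2 x v"
      using canonical so c x unfolding canonically_oriented_def by (metis IntI)
    then have "ip (column 1 (F x)) (diff_in c (\<lambda>y. column 3 (F y)) x v) = ip (column 2 (F x)) (diff_in c (\<lambda>y. column 3 (F y)) x v)"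
      by (simp add: phi_frame[OF cF c(1) x c(2)] frame_skew[OF cF c(1) x c(2), of 3])
    then show ?thesis
      using ip_expand[OF frame_isometry[OF cF x], of "C1 x"] C(1-3)[OF x] C4[OF x] by simp
  qed
  finally have 3: "ip (column 3 (F x)) (C2 x) = 0" using \<theta>(1) by simp
  show "ip (C2 x) (C2 x) = 0"
    using ip_expand[OF frame_isometry[OF cF x], of "C2 x" "C2 x"] 12 3 4 by simp
  show "bivector (C1 x) (C2 x) \<noteq> 0"
    \<comment> \<open>Column 0 is orthogonal to \<open>C1\<close> but not to \<open>C2\<close>, so
      the two cannot be parallel.\<close>
    using bivector_zero_imp_parallel[OF _ nz[OF x], of "C2 x"] C(1,6)[OF x] by auto
qed

end

section \<open>Adapted frames and the dual map\<close>

context gauss_curve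
begin

text \<open>Trades the differential conditions on an adapted frame for pointwise ones on
  \<open>C1\<close>, \<open>C2\<close>, \<open>C3\<close>. Here \<epsilon> becomes the normalized
  \<open>h\<close>, and \<open>n\<close> is determined by
  \<open>\<phi>\<^sup>2\<^sub>1 = n \<theta>\<close>.\<close>

lemma adapted_frameI:
  assumes G: "conformal_frame X A f U G"
    and N: "\<And>y. y \<in> U \<Longrightarrow> N y = column 3 (G y)"
    and C1: "\<And>y. y \<in> U \<Longrightarrow> C1 y = \<kappa> *\<^sub>R (column 1 (G y) - column 2 (G y))"
    and C2: "\<And>y. y \<in> U \<Longrightarrow> ip (column 0 (G y)) (C2 y) = \<epsilon>"
    and units: "\<kappa> * \<kappa> = 1" "\<epsilon> * \<epsilon> = 1"
    and null: "\<And>y. y \<in> U \<Longrightarrow> ip (C2 y) (C2 y) = 0"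
    and n: "\<And>y. y \<in> U \<Longrightarrow> ip (column 1 (G y) + column 2 (G y)) (C2 y) = 2 * \<kappa> * n y"
      "\<And>y. y \<in> U \<Longrightarrow> 3 * n y = - \<epsilon> * ip (column 0 (G y)) (C3 y)"
    and orient: "\<And>c x. c \<in> A \<Longrightarrow> x \<in> U \<Longrightarrow> x \<in> dom c \<Longrightarrow>
      wedge (phi c G 1 0 x) (phi c G 2 0 x) (axis 1 1) (axis 2 1) > 0"
  shows "adapted_frame X A f U G \<and> (\<forall>y\<in>U. column 4 (G y) = - \<epsilon> *\<^sub>R (C2 y + n y *\<^sub>R C1 y))"
proof -
  note openU = frame_open[OF G]
  note gr = frame_ip[OF frame_isometry[OF G]]
  have C1_ip: "ip (column j (G y)) (C1 y) = \<kappa> * (ip (column j (G y)) (column 1 (G y)) - ip (column j (G y)) (column 2 (G y)))"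
    if "y \<in> U" for j y
    using C1[OF that] by simp
  have C1j: "ip (column 0 (G y)) (C1 y) = 0" "ip (column 1 (G y)) (C1 y) = - \<kappa>" "ip (column 2 (G y)) (C1 y) = - \<kappa>"
    "ip (column 3 (G y)) (C1 y) = 0" "ip (column 4 (G y)) (C1 y) = 0" if "y \<in> U" for y
    using gr[OF that] by (simp_all add: C1_ip[OF that])
  have C11: "ip (C1 y) (C1 y) = 0" if "y \<in> U" for y
    using ip_expand[OF frame_isometry[OF G that], of "C1 y" "C1 y"] C1j[OF that] by simp
  have C2_ip: "ip (column 1 (G y)) (C2 y) = \<kappa> * n y" "ip (column 2 (G y)) (C2 y) = \<kappa> * n y"
      "ip (column 3 (G y)) (C2 y) = 0" "ip (column 4 (G y)) (C2 y) = 0" if y: "y \<in> U" for y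
  proof -
    have "y \<in> topspace X" using y openU openin_subset by blast
    then obtain c where c: "c \<in> A" "y \<in> dom c" by (rule obtain_chart)
    obtain \<theta> v where \<theta>: "\<theta> v \<noteq> 0" "\<And>v. diff_in c N y v = \<theta> v *\<^sub>R C1 y"
      "\<And>v. diff_in c C1 y v = \<theta> v *\<^sub>R C2 y" using obtain_form[OF c] by metis
    have D3: "diff_in c (\<lambda>y. column 3 (G y)) y v = \<theta> v *\<^sub>R C1 y" for v
      using diff_in_cong[OF c(1) openU y c(2) smooth_sub(1)[OF openU] N] \<theta>(2) by simp
    show 3: "ip (column 3 (G y)) (C2 y) = 0"
      using diff_perp[OF G c(1) y c(2) smooth_sub(2)[OF openU] C1j(4), of v] \<theta>(1)
      by (simp add: D3 \<theta>(3) C11[OF y])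
    have "\<kappa> * (ip (column 1 (G y)) (C2 y) - ip (column 2 (G y)) (C2 y)) = 0"
      using C1_C2_perp[OF openU C11 y] C1[OF y] by simp
    then have "ip (column 1 (G y)) (C2 y) = ip (column 2 (G y)) (C2 y)"
      using units(1) by auto
    with n(1)[OF y] show 12: "ip (column 1 (G y)) (C2 y) = \<kappa> * n y" "ip (column 2 (G y)) (C2 y) = \<kappa> * n y"
      by simp_all
    have "\<epsilon> * ip (column 4 (G y)) (C2 y) = 0"
      using ip_expand[OF frame_isometry[OF G y], of "C2 y" "C2 y"] null[OF y] C2[OF y] 3 12 by simp
    then show "ip (column 4 (G y)) (C2 y) = 0"
      using units(2) by auto
  qed
  \<comment> \<open>\<open>C2\<close> has components only along column 4 and along
    \<open>C1\<close>; solving for column 4 uses that \<epsilon> is its own inverse.\<close>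
  have G4: "column 4 (G y) = - \<epsilon> *\<^sub>R (C2 y + n y *\<^sub>R C1 y)" if y: "y \<in> U" for y
  proof -
    have "\<forall>j. ip (column j (G y)) (column 4 (G y)) = ip (column j (G y)) (- \<epsilon> *\<^sub>R (C2 y + n y *\<^sub>R C1 y))"
      unfolding all_5 using gr[OF y] C1j[OF y] C2_ip[OF y] C2[OF y] units(2) by simp
    then show ?thesis by (intro frame_eqI[OF frame_isometry[OF G y]]) blast
  qed
  have forms: "phi c G 3 0 x v = 0" "phi c G 3 4 x v = 0" "phi c G 3 1 x v = \<epsilon> * (phi c G 1 0 x v + phi c G 2 0 x v)"
      "phi c G 3 2 x v = \<epsilon> * (phi c G 1 0 x v + phi c G 2 0 x v)" "phi c G 0 0 x v = 2 * phi c G 2 1 x v"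
      "phi c G 1 4 x v + phi c G 2 4 x v = 0"
    if c: "c \<in> A" and x: "x \<in> U" "x \<in> dom c" for c x v
  proof -
    obtain \<theta> where \<theta>: "\<And>v. diff_in c N x v = \<theta> v *\<^sub>R C1 x" "\<And>v. diff_in c C1 x v = \<theta> v *\<^sub>R C2 x"
      "\<And>v. diff_in c C2 x v = \<theta> v *\<^sub>R C3 x" using obtain_form[OF c x(2)] by metis
    define D where "D k = diff_in c (\<lambda>y. column k (G y)) x v" for k
    note ph = phi_frame[OF G c x, of _ v, folded D_def]
      and sk = frame_skew[OF G c x, of _ _ v, folded D_def]
      and diag = frame_skew_diag[OF G c x, of _ v, folded D_def]
      and perp = diff_perp[OF G c x, of _ _ _ v, folded D_def]
    have D3: "D 3 = \<theta> v *\<^sub>R C1 x"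
      unfolding D_def using diff_in_cong[OF c openU x smooth_sub(1)[OF openU] N] \<theta>(1) by simp
    show "phi c G 3 0 x v = 0" "phi c G 3 4 x v = 0"
      unfolding ph using C1j[OF x(1)] by (simp_all add: sk[of 3] D3)
    have 3: "phi c G 3 1 x v = \<kappa> * \<theta> v" "phi c G 3 2 x v = \<kappa> * \<theta> v"
      unfolding ph using C1j[OF x(1)] by (simp_all add: sk[of 3] D3)
    have C1D0: "ip (C1 x) (D 0) = - \<theta> v * \<epsilon>"
      using perp[OF smooth_sub(2)[OF openU] C1j(1)] by (simp add: \<theta>(2) C2[OF x(1)])
    then have "\<kappa> * (ip (column 1 (G x)) (D 0) - ip (column 2 (G x)) (D 0)) = - \<theta> v * \<epsilon>"
      using C1[OF x(1)] by simp
    then have "\<kappa> * \<kappa> * (ip (column 1 (G x)) (D 0) - ip (column 2 (G x)) (D 0)) = - \<kappa> * \<theta> v * \<epsilon>"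
      by (simp only: mult.assoc)
    then have "phi c G 1 0 x v + phi c G 2 0 x v = \<kappa> * \<theta> v * \<epsilon>"
      using units(1) by (simp add: ph)
    then have "\<epsilon> * (phi c G 1 0 x v + phi c G 2 0 x v) = \<kappa> * \<theta> v"
      using units(2) by simp
    with 3 show "phi c G 3 1 x v = \<epsilon> * (phi c G 1 0 x v + phi c G 2 0 x v)"
      "phi c G 3 2 x v = \<epsilon> * (phi c G 1 0 x v + phi c G 2 0 x v)" by simp_all
    have "ip (C2 x) (D 0) = - \<theta> v * ip (column 0 (G x)) (C3 x)"
      using perp[OF smooth_sub(3)[OF openU] C2] by (simp add: \<theta>(3))
    then have "phi c G 0 0 x v = - \<theta> v * (\<epsilon> * ip (column 0 (G x)) (C3 x)) - n x * \<theta> v * (\<epsilon> * \<epsilon>)"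
      unfolding ph(1) G4[OF x(1)] using C1D0 by (simp add: algebra_simps)
    \<comment> \<open>The source of the factor 3: the \<open>C3\<close> term contributes
      \<open>3 n \<theta>\<close> and the \<open>C1\<close> term \<open>- n \<theta>\<close>, which
      must add up to \<open>2 \<phi>\<^sup>2\<^sub>1\<close>.\<close>
    also have "\<dots> = 2 * (n x * \<theta> v)"
    proof -
      have e: "\<epsilon> * ip (column 0 (G x)) (C3 x) = - 3 * n x" using n(2)[OF x(1)] by simp
      show ?thesis unfolding e units(2) by simp
    qed
    also have "n x * \<theta> v = phi c G 2 1 x v"
    proof -
      have "\<theta> v * (\<kappa> * n x) = - ip (C1 x) (D 2)"
        using perp[OF smooth_sub(2)[OF openU] C1j(3)] by (simp add: \<theta>(2) C2_ip[OF x(1)])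
      also have "\<dots> = \<kappa> * ip (column 2 (G x)) (D 1)"
        using C1[OF x(1)] by (simp add: diag sk[of 1 2])
      finally have "\<kappa> * \<kappa> * (n x * \<theta> v) = \<kappa> * \<kappa> * ip (column 2 (G x)) (D 1)"
        by (simp add: mult_ac)
      then show ?thesis using units(1) by (simp add: ph)
    qed
    finally show "phi c G 0 0 x v = 2 * phi c G 2 1 x v" .
    \<comment> \<open>Column 4 is orthogonal to both \<open>C1\<close> and \<open>C2\<close>, so
      differentiating the first relation gives this. The sum of the two forms is thus zero, which is
      stronger than the wedge condition.\<close>
    have "\<kappa> * (ip (column 1 (G x)) (D 4) - ip (column 2 (G x)) (D 4)) = 0"
      using perp[OF smooth_sub(2)[OF openU] C1j(5)] C1[OF x(1)] by (simp add: \<theta>(2) C2_ip[OF x(1)])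
    then show "phi c G 1 4 x v + phi c G 2 4 x v = 0"
      using units(1) by (auto simp: ph)
  qed
  have so: "second_order_frame X A f U G"
    unfolding second_order_frame_def using G orient forms
    by (auto simp: wedge_def algebra_simps)
  have "\<epsilon> \<noteq> 0 \<and> \<epsilon> = sgn \<epsilon>"
  proof -
    have "(\<epsilon> - 1) * (\<epsilon> + 1) = 0" using units(2) by (simp add: algebra_simps)
    then have "\<epsilon> = 1 \<or> \<epsilon> = - 1" by auto
    then show ?thesis by auto
  qed
  then have "adapted_frame X A f U G"
    unfolding adapted_frame_def using so forms by (auto simp: wedge_def intro!: exI[of _ \<epsilon>])
  with G4 show ?thesis by blast
qed

lemma ray_scale:
  assumes "r > 0"
  shows "ray (r *\<^sub>R V) = ray V"
proof -
  have "\<exists>t'>0. t *\<^sub>R V = t' *\<^sub>R r *\<^sub>R V" if "t > 0" for t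
    using assms that by (intro exI[of _ "t / r"]) simp
  moreover have "\<exists>t'>0. t *\<^sub>R r *\<^sub>R V = t' *\<^sub>R V" if "t > 0" for t
    using assms that by (intro exI[of _ "t * r"]) simp
  ultimately show ?thesis
    unfolding ray_def by blast
qed

text \<open>In the biisotropic case this is the vector \<open>F\<^sub>4\<close> of an adapted frame. It depends on \<open>V\<close> only
  through the ray \<open>f x\<close>, which makes the local adapted frames agree on the dual map.\<close>

definition dual_vector :: "real^5 \<Rightarrow> 'a \<Rightarrow> real^5" where
  "dual_vector V x = - sgn (ip V (C2 x)) *\<^sub>R (C2 x - (ip V (C3 x) / (3 * ip V (C2 x))) *\<^sub>R C1 x)"

lemma dual_vector_scale: "r > 0 \<Longrightarrow> dual_vector (r *\<^sub>R V) x = dual_vector V x"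
  by (simp add: dual_vector_def sgn_mult)

text \<open>A second order frame is corrected by \<open>gauge\<close>: \<open>r\<close> normalizes
  the pairing of column 0 with \<open>C2\<close>, \<open>s\<close> and \<open>a\<close> match
  \<open>C1\<close> with column 1 minus column 2, and \<open>b\<close> adjusts the pairing of their
  sum with \<open>C2\<close>.\<close>

lemma adapted_frame_exists:
  assumes null: "\<And>y. y \<in> topspace X \<Longrightarrow> ip (C2 y) (C2 y) = 0" and x: "x \<in> topspace X"
  shows "\<exists>U G. x \<in> U \<and> adapted_frame X A f U G \<and> (\<forall>y\<in>U. column 4 (G y) = dual_vector (column 0 (G y)) y)"
proof -
  have "\<exists>W F. x \<in> W \<and> second_order_frame X A f W F \<and> (\<forall>y\<in>W. N y = column 3 (F y))"
    using gauss x unfolding conformal_gauss_map_def by (rule bspec)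
  then obtain W F where xW: "x \<in> W" and F: "second_order_frame X A f W F"
    and NF: "\<forall>y\<in>W. N y = column 3 (F y)"
    by (elim exE conjE)
  note cF = second_order_conformal[OF F]
  note openW = frame_open[OF cF]
  define q where "q y = - ip (column 1 (F y)) (C1 y)" for y
  define k where "k y = ip (column 0 (F y)) (C2 y)" for y
  define \<kappa> \<epsilon> where "\<kappa> = sgn (q x)" and "\<epsilon> = sgn (k x)"
  have nz: "q y \<noteq> 0" "k y \<noteq> 0" if "y \<in> W" for y
    using C1_frame(5,6)[OF F that] by (auto simp: q_def k_def)
  have units: "\<kappa> * \<kappa> = 1" "\<epsilon> * \<epsilon> = 1"
    using nz[OF xW] by (auto simp: \<kappa>_def \<epsilon>_def sgn_if)
  have smW: "smooth_map A W (\<lambda>y. \<kappa> * q y)" "smooth_map A W (\<lambda>y. \<epsilon> * k y)"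
  proof -
    note s = smooth_map_ip[OF openW smooth_column[OF cF]] and cm = smooth_map_mult[OF openW smooth_map_const[OF openW]]
    show "smooth_map A W (\<lambda>y. \<kappa> * q y)" "smooth_map A W (\<lambda>y. \<epsilon> * k y)"
      using cm[OF s[OF smooth_sub(2)[OF openW], of 1], of "- \<kappa>"] cm[OF s[OF smooth_sub(3)[OF openW], of 0], of \<epsilon>]
      by (simp_all add: q_def k_def)
  qed
  \<comment> \<open>On this neighbourhood \<open>q\<close> and \<open>k\<close> keep the signs they
    have at \<open>x\<close>, so \<kappa> and \<epsilon> are constants and the parameters
    \<open>r\<close>, \<open>s\<close> stay positive, as \<open>G23_gauge\<close> demands.\<close>
  define U where "U = {y \<in> {y \<in> W. \<kappa> * q y \<in> {0<..}}. \<epsilon> * k y \<in> {0<..}}"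
  have open1: "openin X {y \<in> W. \<kappa> * q y \<in> {0<..}}"
    by (rule openin_smooth_preimage[OF openW smW(1)]) simp
  have openU: "openin X U"
    unfolding U_def by (rule openin_smooth_preimage[OF open1 smooth_map_subset[OF smW(2)]]) auto
  have U: "y \<in> W" "\<kappa> * q y > 0" "\<epsilon> * k y > 0" if "y \<in> U" for y
    using that by (auto simp: U_def)
  have UW: "U \<subseteq> W" using U by blast
  have xU: "x \<in> U"
    using xW nz[OF xW] by (auto simp: U_def \<kappa>_def \<epsilon>_def sgn_if)
  \<comment> \<open>This solves the equation with factor 3 in \<open>adapted_frameI\<close>; the
    quotient is unchanged when column 0 is rescaled, so it can be computed in the old frame.\<close>
  define m where "m y = - ip (column 0 (F y)) (C3 y) / (3 * k y)" for y
  define a where "a y = - ip (column 4 (F y)) (C1 y) / q y" for y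
  define b where "b y = (2 * q y * m y - ip (column 1 (F y) + column 2 (F y)) (C2 y)) / k y" for y
  define G where "G y = F y ** gauge (\<epsilon> / k y) (\<kappa> * q y) (a y) (b y)" for y
  have r: "\<epsilon> / k y > 0" if "y \<in> U" for y
    using U(3)[OF that] by (simp add: zero_less_divide_iff zero_less_mult_iff)
  note so = C1_frame[OF F]
  have C1F: "C1 y = q y *\<^sub>R (column 1 (F y) - column 2 (F y) + a y *\<^sub>R column 0 (F y))" if y: "y \<in> W" for y
  proof -
    have "\<forall>j. ip (column j (F y)) (C1 y) = ip (column j (F y)) (q y *\<^sub>R (column 1 (F y) - column 2 (F y) + a y *\<^sub>R column 0 (F y)))"
      unfolding all_5 using frame_ip[OF frame_isometry[OF cF y]] so(1-3)[OF y] nz[OF y] by (simp add: q_def a_def)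
    then show ?thesis by (intro frame_eqI[OF frame_isometry[OF cF y]]) blast
  qed
  note G_col = column_gauge[of "F y" "\<epsilon> / k y" "\<kappa> * q y" "a y" "b y" for y, folded G_def]
  have s: "\<kappa> * q y \<noteq> 0" "\<epsilon> / k y \<noteq> 0" if "y \<in> U" for y
    using U[OF that] r[OF that] by auto
  have G12: "column 1 (G y) - column 2 (G y) = (\<kappa> * q y) *\<^sub>R (column 1 (F y) - column 2 (F y) + a y *\<^sub>R column 0 (F y))"
    "column 1 (G y) + column 2 (G y) = (1 / (\<kappa> * q y)) *\<^sub>R (column 1 (F y) + column 2 (F y) + b y *\<^sub>R column 0 (F y))" for y
    unfolding G_col by (simp_all add: vec_eq_iff field_simps)
  have conf: "conformal_frame X A f U G"
    unfolding conformal_frame_def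
  proof (intro conjI ballI openU)
    note sF = smooth_map_subset[OF smooth_column[OF cF] UW]
    note ip' = smooth_map_ip[OF openU sF] and c' = smooth_map_const[OF openU]
    have sq: "smooth_map A U q" "smooth_map A U k"
      using smooth_map_diff[OF openU c'[of 0] ip'[OF smooth_sub(2)[OF openU], of 1]] ip'[OF smooth_sub(3)[OF openU], of 0]
      by (simp_all add: q_def[abs_def] k_def[abs_def])
    have nz': "q y \<noteq> 0" "k y \<noteq> 0" if "y \<in> U" for y using nz U(1)[OF that] by auto
    have sm: "smooth_map A U m"
      using smooth_map_divide[OF openU smooth_map_diff[OF openU c'[of 0] ip'[OF smooth_sub(4)[OF openU], of 0]]
          smooth_map_mult[OF openU c'[of 3] sq(2)]] nz' by (simp add: m_def[abs_def])
    have sa: "smooth_map A U a"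
      using smooth_map_divide[OF openU smooth_map_diff[OF openU c'[of 0] ip'[OF smooth_sub(2)[OF openU], of 4]] sq(1)] nz'
      by (simp add: a_def[abs_def])
    have sb: "smooth_map A U b"
      unfolding b_def
      by (intro smooth_map_divide[OF openU] smooth_map_diff[OF openU] smooth_map_mult[OF openU] c' sq sm
          smooth_map_ip[OF openU] smooth_map_add[OF openU] sF smooth_sub(3)[OF openU] nz')
    show "smooth_map A U G"
      unfolding G_def
      by (intro smooth_map_gauge[OF openU] smooth_map_subset[OF frame_smooth[OF cF] UW] smooth_map_divide[OF openU]
          smooth_map_mult[OF openU] c' sq sa sb nz' s)
    fix y assume y: "y \<in> U"
    show "G y \<in> G23"
      unfolding G_def using cF U[OF y] r[OF y] by (intro G23_gauge) (auto simp: conformal_frame_def)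
    show "f y = ray (column 0 (G y))"
      unfolding frame_ray[OF cF U(1)[OF y]] G_col by (rule ray_scale[OF r[OF y], symmetric])
  qed
  have k_inv: "ip (column 0 (G y)) V = \<epsilon> / k y * ip (column 0 (F y)) V" for y V
    unfolding G_col by simp
  have main: "adapted_frame X A f U G \<and> (\<forall>y\<in>U. column 4 (G y) = - \<epsilon> *\<^sub>R (C2 y + m y *\<^sub>R C1 y))"
  proof (rule adapted_frameI[OF conf])
    fix y assume y: "y \<in> U"
    note yW = U(1)[OF y]
    show "N y = column 3 (G y)" unfolding G_col by (rule NF[rule_format, OF yW])
    show "C1 y = \<kappa> *\<^sub>R (column 1 (G y) - column 2 (G y))"
      unfolding G12 C1F[OF yW] using units(1) by (simp flip: mult.assoc)
    show "ip (column 0 (G y)) (C2 y) = \<epsilon>"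
      unfolding k_inv using nz[OF yW] by (simp add: k_def)
    show "ip (C2 y) (C2 y) = 0"
      using null yW openW openin_subset by blast
    have "ip (column 1 (G y) + column 2 (G y)) (C2 y) = 2 * q y * m y / (\<kappa> * q y)"
      unfolding G12 using nz[OF yW] by (simp add: b_def k_def add_divide_distrib)
    also have "\<dots> = 2 * \<kappa> * m y"
      using nz[OF yW] units(1) s(1)[OF y] by (simp add: field_simps)
    finally show "ip (column 1 (G y) + column 2 (G y)) (C2 y) = 2 * \<kappa> * m y" .
    have "- \<epsilon> * ip (column 0 (G y)) (C3 y) = - (\<epsilon> * \<epsilon>) * ip (column 0 (F y)) (C3 y) / k y"
      unfolding k_inv by simp
    then show "3 * m y = - \<epsilon> * ip (column 0 (G y)) (C3 y)"
      unfolding units by (simp add: m_def)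
  next
    fix c y assume c: "c \<in> A" and y: "y \<in> U" "y \<in> dom c"
    note yW = U(1)[OF y(1)]
    define D where "D = diff_in c (\<lambda>y. column 0 (F y)) y"
    define s where "s = \<kappa> * q y"
    \<comment> \<open>Removes the term of \<open>d (r F_0)\<close> that comes from differentiating
      \<open>r\<close>.\<close>
    have F0: "ip (column 0 (F y)) (column j (G y)) = 0" if "j \<in> {1, 2}" for j
    proof -
      have "ip (column 0 (G y)) (column j (G y)) = 0"
        using frame_ip[OF frame_isometry[OF conf y(1)]] that by auto
      then show ?thesis unfolding k_inv using s(2)[OF y(1)] by simp
    qed
    have sr: "smooth_map A U (\<lambda>y. \<epsilon> / k y)"
    proof -
      have "smooth_map A U k"
        using smooth_map_ip[OF openU smooth_map_subset[OF smooth_column[OF cF] UW] smooth_sub(3)[OF openU], of 0]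
        by (simp add: k_def[abs_def])
      then show ?thesis
        using nz U(1) by (intro smooth_map_divide[OF openU] smooth_map_const[OF openU]) auto
    qed
    have D: "ip (column j (G y)) (diff_in c (\<lambda>y. column 0 (G y)) y v) = \<epsilon> / k y * ip (column j (G y)) (D v)"
      if "j \<in> {1, 2}" for j v
      unfolding G_col(1) D_def
        diff_in_bilinear[OF c y bounded_bilinear_scaleR sr smooth_map_subset[OF smooth_column[OF cF] UW]]
      using F0[OF that] by (simp add: ip_commute[of _ "column 0 (F y)"])
    have D': "ip (column 1 (G y)) (D v) = (s + 1 / s) / 2 * ip (column 1 (F y)) (D v) + (1 / s - s) / 2 * ip (column 2 (F y)) (D v)"
      "ip (column 2 (G y)) (D v) = (1 / s - s) / 2 * ip (column 1 (F y)) (D v) + (s + 1 / s) / 2 * ip (column 2 (F y)) (D v)" for v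
      unfolding G_col s_def D_def using frame_skew_diag[OF cF c yW y(2), of 0] by simp_all
    have "wedge (\<lambda>v. ip (column 1 (F y)) (D v)) (\<lambda>v. ip (column 2 (F y)) (D v)) (axis 1 1) (axis 2 1) < 0"
      unfolding D_def by (rule second_order_ip(2)[OF F c yW y(2)])
    moreover have "wedge (phi c G 1 0 y) (phi c G 2 0 y) u v
      = - ((\<epsilon> / k y)\<^sup>2 * ((s + 1 / s)\<^sup>2 - (1 / s - s)\<^sup>2) / 4) * wedge (\<lambda>v. ip (column 1 (F y)) (D v)) (\<lambda>v. ip (column 2 (F y)) (D v)) u v" for u v
      unfolding wedge_def phi_frame[OF conf c y] D[of 1, simplified] D[of 2, simplified] D'
      by (simp add: power2_eq_square algebra_simps add_divide_distrib diff_divide_distrib)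
    \<comment> \<open>The change of columns 1 and 2 modulo column 0 has determinant 1, so
      orientation is preserved.\<close>
    moreover have "(s + 1 / s)\<^sup>2 - (1 / s - s)\<^sup>2 = 4"
      using s(1)[OF y(1)] unfolding s_def by (simp add: power2_eq_square field_simps)
    ultimately show "wedge (phi c G 1 0 y) (phi c G 2 0 y) (axis 1 1) (axis 2 1) > 0"
      using s(2)[OF y(1)] by (simp add: mult_less_0_iff)
  qed (use units in auto)
  moreover have "dual_vector (column 0 (G y)) y = - \<epsilon> *\<^sub>R (C2 y + m y *\<^sub>R C1 y)" if y: "y \<in> U" for y
  proof -
    have "ip (column 0 (G y)) (C2 y) = \<epsilon>" unfolding k_inv using nz[OF U(1)[OF y]] by (simp add: k_def)
    moreover have "ip (column 0 (G y)) (C3 y) / (3 * \<epsilon>) = - m y"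
      unfolding k_inv using units(2) by (auto simp: m_def)
    moreover have "sgn \<epsilon> = \<epsilon>" by (simp add: \<epsilon>_def)
    ultimately show ?thesis by (simp add: dual_vector_def)
  qed
  ultimately show ?thesis using xU by (intro exI[of _ U] exI[of _ G]) auto
qed

text \<open>Forward, column 4 of an adapted frame serves as the lift of the dual map. Backward,
  every lift of the constructed dual map lies in the isotropic plane spanned by \<open>C1\<close>
  and \<open>C2\<close>.\<close>

lemma exceptional_iff:
  "exceptional X A f N \<longleftrightarrow>
    (\<forall>x\<in>topspace X. ip (C1 x) (C1 x) = 0 \<and> ip (C2 x) (C2 x) = 0 \<and> bivector (C1 x) (C2 x) \<noteq> 0)"
proof
  assume "exceptional X A f N"
  then obtain f' where f': "dual_map X A f f'"
    and ex: "\<forall>U H. openin X U \<longrightarrow> smooth_map A U H \<longrightarrow> (\<forall>x\<in>U. H x \<in> f' x) \<longrightarrow>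
      (\<forall>c\<in>A. \<forall>x\<in>U \<inter> dom c. \<forall>v. ip (diff_in c N x v) (diff_in c H x v) = 0)"
    unfolding exceptional_def by (elim exE conjE)
  show "\<forall>x\<in>topspace X. ip (C1 x) (C1 x) = 0 \<and> ip (C2 x) (C2 x) = 0 \<and> bivector (C1 x) (C2 x) \<noteq> 0"
  proof
    fix x assume "x \<in> topspace X"
    with f' have "\<exists>U F. x \<in> U \<and> adapted_frame X A f U F \<and> (\<forall>y\<in>U. f' y = ray (column 4 (F y)))"
      unfolding dual_map_def by (rule bspec)
    then obtain U F where F: "x \<in> U" "adapted_frame X A f U F" "\<forall>y\<in>U. f' y = ray (column 4 (F y))"
      by (elim exE conjE)
    note cF = second_order_conformal[OF adapted_second_order[OF F(2)]]
    have "\<forall>y\<in>U. column 4 (F y) \<in> f' y"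
      using F(3) by (auto simp: ray_def intro: exI[of _ 1])
    from ex[rule_format, OF frame_open[OF cF] smooth_column[OF cF] bspec[OF this]]
    have "ip (diff_in c N x v) (diff_in c (\<lambda>y. column 4 (F y)) x v) = 0" if "c \<in> A" "x \<in> dom c" for c v
      using that F(1) by simp
    from biisotropic_at[OF F(2,1) this]
    show "ip (C1 x) (C1 x) = 0 \<and> ip (C2 x) (C2 x) = 0 \<and> bivector (C1 x) (C2 x) \<noteq> 0"
      by simp
  qed
next
  assume *: "\<forall>x\<in>topspace X. ip (C1 x) (C1 x) = 0 \<and> ip (C2 x) (C2 x) = 0 \<and> bivector (C1 x) (C2 x) \<noteq> 0"
  \<comment> \<open>The arbitrary choice of \<open>V\<close> in the ray is immaterial by
    \<open>dual_vector_scale\<close>, so this global map agrees with all local adapted frames built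
    above.\<close>
  define f' where "f' x = ray (dual_vector (SOME V. V \<in> f x) x)" for x
  have "dual_map X A f f'"
    unfolding dual_map_def
  proof
    fix x assume "x \<in> topspace X"
    then have "\<exists>U G. x \<in> U \<and> adapted_frame X A f U G \<and> (\<forall>y\<in>U. column 4 (G y) = dual_vector (column 0 (G y)) y)"
      using * by (intro adapted_frame_exists) auto
    then obtain U G where G: "x \<in> U" "adapted_frame X A f U G"
        "\<forall>y\<in>U. column 4 (G y) = dual_vector (column 0 (G y)) y"
      by (elim exE conjE)
    have "f' y = ray (column 4 (G y))" if y: "y \<in> U" for y
    proof -
      have fy: "f y = ray (column 0 (G y))"
        using frame_ray[OF second_order_conformal[OF adapted_second_order[OF G(2)]] y] .
      then have "column 0 (G y) \<in> f y" by (auto simp: ray_def intro: exI[of _ 1])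
      then have "(SOME V. V \<in> f y) \<in> f y" by (rule someI)
      then obtain r where "r > 0" "(SOME V. V \<in> f y) = r *\<^sub>R column 0 (G y)"
        unfolding fy by (auto simp: ray_def)
      then show ?thesis by (simp add: f'_def dual_vector_scale G(3)[rule_format, OF y])
    qed
    with G(1,2) show "\<exists>U F. x \<in> U \<and> adapted_frame X A f U F \<and> (\<forall>y\<in>U. f' y = ray (column 4 (F y)))"
      by (intro exI[of _ U] exI[of _ G]) simp
  qed
  moreover have "ip (diff_in c N x v) (diff_in c H x v) = 0"
    if U: "openin X U" "smooth_map A U H" and H: "\<forall>x\<in>U. H x \<in> f' x" and c: "c \<in> A" and x: "x \<in> U" "x \<in> dom c"
    for U H c x v
  proof -
    have C12: "ip (C1 y) (C2 y) = 0" if "y \<in> topspace X" for y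
      by (rule C1_C2_perp[OF openin_topspace _ that]) (use * in blast)
    have CH: "ip (C1 y) (H y) = 0 \<and> ip (C2 y) (H y) = 0" if "y \<in> U" for y
    proof -
      have "y \<in> topspace X" using that U(1) openin_subset by blast
      moreover have "\<exists>r. H y = r *\<^sub>R dual_vector (SOME V. V \<in> f y) y"
        using bspec[OF H that] by (auto simp: f'_def ray_def)
      then obtain r where "H y = r *\<^sub>R dual_vector (SOME V. V \<in> f y) y" ..
      ultimately show ?thesis
        using * C12 by (simp add: dual_vector_def ip_commute[of "C2 y" "C1 y"])
    qed
    obtain \<theta> where \<theta>: "\<And>v. diff_in c N x v = \<theta> v *\<^sub>R C1 x" "\<And>v. diff_in c C1 x v = \<theta> v *\<^sub>R C2 x"
      using obtain_form[OF c x(2)] by metis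
    \<comment> \<open>The first term is a multiple of the pairing of \<open>C2\<close> with
      \<open>H\<close>, hence zero; so \<open>C1\<close>, and with it \<open>dN\<close>, is
      orthogonal to \<open>dH\<close>.\<close>
    have "ip (diff_in c C1 x v) (H x) + ip (C1 x) (diff_in c H x v) = 0"
      by (rule diff_in_ip_const[OF c U(1) x smooth_sub(2)[OF U(1)] U(2)]) (use CH in blast)
    then show ?thesis using CH[OF x(1)] by (simp add: \<theta>)
  qed
  ultimately show "exceptional X A f N"
    unfolding exceptional_def by (intro exI[of _ f']) simp
qed

end

section \<open>Transfer of the pointwise criterion to the directrix curve\<close>

theorem proposition4p2:
  fixes X :: "'a topology"
    and A :: "('a, real^2) chart set"
    and f :: "'a \<Rightarrow> (real^5) set"
    and N :: "'a \<Rightarrow> real^5"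
    and L :: "('a set, real) chart set"
    and \<Gamma> :: "'a set \<Rightarrow> real^5"
    and \<zeta> :: "('a set, real) chart \<Rightarrow> 'a set \<Rightarrow> real \<Rightarrow> real"
  assumes "connected_oriented_surface X A"
    and "quasi_umbilical X A f N"
    and "canonically_oriented X A f"
    and "regular X A N"
    and "leaf_manifold X A N L"
    and "directrix_curve X A N L \<Gamma>"
    and "nowhere_zero_one_form L \<zeta>"
  shows "exceptional X A f N \<longleftrightarrow> biisotropic (leaf_space X A N) L \<zeta> \<Gamma>"
proof -
  interpret leaf_surface X A N L \<zeta>
    using assms(1,5,7) by unfold_locales (auto simp: connected_oriented_surface_def)
  let ?G1 = "deriv_wrt L \<zeta> \<Gamma>"
  let ?G2 = "deriv_wrt L \<zeta> ?G1"
  let ?G3 = "deriv_wrt L \<zeta> ?G2"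
  let ?\<pi> = "leaf X A N"
  have s0: "smooth_map L (topspace (leaf_space X A N)) \<Gamma>" and N: "\<And>x. x \<in> topspace X \<Longrightarrow> N x = \<Gamma> (?\<pi> x)"
    and imm: "immersed_curve (leaf_space X A N) L \<Gamma>"
    using assms(6) by (auto simp: directrix_curve_def immersed_curve_def)
  note s1 = leaves.smooth_map_deriv_wrt[OF s0]
  note s2 = leaves.smooth_map_deriv_wrt[OF s1]
  note s3 = leaves.smooth_map_deriv_wrt[OF s2]
  \<comment> \<open>The abstract \<open>C1\<close>, \<open>C2\<close>, \<open>C3\<close> become the
    pullbacks of three successive derivatives of \<Gamma>, sharing the form from
    \<open>pullback_form\<close>.\<close>
  interpret gauss_curve X A f N "\<lambda>x. ?G1 (?\<pi> x)" "\<lambda>x. ?G2 (?\<pi> x)" "\<lambda>x. ?G3 (?\<pi> x)"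
  proof unfold_locales
    show "smooth_map A (topspace X) N"
      by (rule smooth_map_cong[OF openin_topspace smooth_map_leaf[OF s0]]) (simp add: N)
    fix c x assume c: "c \<in> A" "x \<in> dom c"
    obtain \<theta> v where \<theta>: "\<theta> v \<noteq> 0" "\<And>H v. smooth_map L (topspace (leaf_space X A N)) H \<Longrightarrow>
        diff_in c (\<lambda>y. H (?\<pi> y)) x v = \<theta> v *\<^sub>R deriv_wrt L \<zeta> H (?\<pi> x)"
      by (rule pullback_form[OF c], rule that)
    have "x \<in> topspace X" using dom_subset c by blast
    then have "diff_in c N x v = \<theta> v *\<^sub>R ?G1 (?\<pi> x)" for v
      using diff_in_cong[OF c(1) openin_topspace _ c(2) smooth_map_leaf[OF s0], of N v] N \<theta>(2)[OF s0] by simp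
    with \<theta>(1) \<theta>(2)[OF s1] \<theta>(2)[OF s2]
    show "\<exists>\<theta>. (\<exists>v. \<theta> v \<noteq> 0) \<and> (\<forall>v. diff_in c N x v = \<theta> v *\<^sub>R ?G1 (?\<pi> x) \<and>
        diff_in c (\<lambda>x. ?G1 (?\<pi> x)) x v = \<theta> v *\<^sub>R ?G2 (?\<pi> x) \<and> diff_in c (\<lambda>x. ?G2 (?\<pi> x)) x v = \<theta> v *\<^sub>R ?G3 (?\<pi> x))"
      by blast
  qed (use assms(2,3) smooth_map_leaf[OF s1] smooth_map_leaf[OF s2] smooth_map_leaf[OF s3] in
      \<open>auto simp: quasi_umbilical_def\<close>)
  show ?thesis
    \<comment> \<open>Every point of the leaf space is the leaf of some \<open>x\<close>, so the
      conditions over the surface and over the leaf space coincide.\<close>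
    unfolding exceptional_iff biisotropic_def Let_def topspace_leaf_space using imm by simp
qed

end
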